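(* Let $G$ be a compact Lie group. For $i=1,2,3$ let $\lambda_i^1,\lambda_i^2\in\widehat G$ and $(\lambda_i,k_i)\in\langle\langle\lambda_i^1,\lambda_i^2\rangle\rangle$, and let $k^1,k^2,k$ be positive integers with $(\lambda_3^n,k^n)\in\langle\langle\lambda_1^n,\lambda_2^n\rangle\rangle$ for $n=1,2$ and $(\lambda_3,k)\in\langle\langle\lambda_1,\lambda_2\rangle\rangle$. Then for any $\mu_3\in\mathtt w(\lambda_3)$, $$\begin{pmatrix}\lambda_1^1&\lambda_1^2&\lambda_1&k_1\\ \lambda_2^1&\lambda_2^2&\lambda_2&k_2\\ \lambda_3^1&\lambda_3^2&\lambda_3&k_3\\ k^1&k^2&k&\end{pmatrix}=\sum_{\underline\mu_1,\underline\mu_2}\ \sum_{\check\mu_1=1}^{m_{\lambda_1}(\hat\mu_1)}\ \sum_{\check\mu_2=1}^{m_{\lambda_2}(\hat\mu_2)}\ \sum_{\check\mu_3^1=1}^{m_{\lambda_3^1}(\hat\mu_3^1)}\ \sum_{\check\mu_3^2=1}^{m_{\lambda_3^2}(\hat\mu_3^2)}\Big(C^{\lambda_1^1,\lambda_1^2,\lambda_1,k_1}_{\mu_1^1,\mu_1^2,\mu_1}\Big)^*\Big(C^{\lambda_2^1,\lambda_2^2,\lambda_2,k_2}_{\mu_2^1,\mu_2^2,\mu_2}\Big)^*\Big(C^{\lambda_1,\lambda_2,\lambda_3,k}_{\mu_1,\mu_2,\mu_3}\Big)^*C^{\lambda_1^1,\lambda_2^1,\lambda_3^1,k^1}_{\mu_1^1,\mu_2^1,\mu_3^1}\,C^{\lambda_1^2,\lambda_2^2,\lambda_3^2,k^2}_{\mu_1^2,\mu_2^2,\mu_3^2}\,C^{\lambda_3^1,\lambda_3^2,\lambda_3,k_3}_{\mu_3^1,\mu_3^2,\mu_3}.$$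 Here the outer sum runs over $\underline\mu_i=(\mu_i^1,\mu_i^2)\in\mathtt w(\lambda_i^1)\times\mathtt w(\lambda_i^2)$, $i=1,2$, such that $\hat\mu_i:=\hat\mu_i^1+\hat\mu_i^2$ is a weight of $D^{\lambda_i}$ for $i=1,2$ and $\hat\mu_3^n:=\hat\mu_1^n+\hat\mu_2^n$ is a weight of $D^{\lambda_3^n}$ for $n=1,2$; and $\mu_i:=(\hat\mu_i,\check\mu_i)$ for $i=1,2$, $\mu_3^n:=(\hat\mu_3^n,\check\mu_3^n)$ for $n=1,2$. The sum over $\underline\mu_1,\underline\mu_2$ may be further restricted to pairs with $\hat\mu_1+\hat\mu_2=\hat\mu_3$, where $\hat\mu_3$ is the weight of $\mu_3$. On the other hand, all relations between the weights may be omitted, so that the sum runs over independent $(\mu_i^1,\mu_i^2)\in\mathtt w(\lambda_i^1)\times\mathtt w(\lambda_i^2)$, $i=1,2,3$, and $\mu_i\in\mathtt w(\lambda_i)$, $i=1,2$.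
   Context: $G$ is a compact Lie group; $\widehat G$ is the set of isomorphism classes of finite-dimensional irreps of $G$, labelled by highest weights $\lambda$. For every $\lambda\in\widehat G$ a concrete unitary irrep $(H_\lambda,D^\lambda)$ is fixed. $\mathtt w(\lambda)$ is the set of weight labels $\mu=(\hat\mu,\check\mu)$, where $\hat\mu$ is a weight of $D^\lambda$ (relative to a fixed Cartan subalgebra of the Lie algebra) and $\check\mu\in\{1,\dots,m_\lambda(\hat\mu)\}$ is a multiplicity counter, $m_\lambda(\hat\mu)$ being the multiplicity of the weight; $\{|\lambda\mu\rangle:\mu\in\mathtt w(\lambda)\}$ is a fixed orthonormal weight basis of $H_\lambda$. For $\lambda_1,\lambda_2\in\widehat G$, $m_{(\lambda_1,\lambda_2)}(\lambda)$ is the multiplicity of $D^\lambda$ in $D^{\lambda_1}\otimes D^{\lambda_2}$ and $\langle\langle\lambda_1,\lambda_2\rangle\rangle=\{(\lambda,k):m_{(\lambda_1,\lambda_2)}(\lambda)>0,\ 1\le k\le m_{(\lambda_1,\lambda_2)}(\lambda)\}$. For every pair $(\lambda_1,\lambda_2)$ a unitary $G$-isomorphism $H_{\lambda_1}\otimes H_{\lambda_2}\cong\bigoplus_{(\lambda,k)\in\langle\langle\lambda_1,\lambda_2\rangle\rangle}H_\lambda$ is fixed once and for all; $\mathrm i_{(\lambda_1,\lambda_2),\lambda,k}:H_\lambda\to H_{\lambda_1}\otimes H_{\lambda_2}$ are the corresponding isometric injections. The ordinary Clebsch–Gordan coefficients of $G$ are $C^{\lambda_1,\lambda_2,\lambda,k}_{\mu_1,\mu_2,\mu}:=\big(\langle\lambda_1\mu_1|\otimes\langle\lambda_2\mu_2|\big)\,\mathrm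 i_{(\lambda_1,\lambda_2),\lambda,k}|\lambda\mu\rangle$. The $9\lambda$ symbol (the $4\times4$ array with empty lower right corner) is, under the hypotheses of the claim, the recoupling coefficient $$\langle\lambda_3\mu|\,A^*\,\Pi\,B\,|\lambda_3\mu\rangle,$$ which by Schur's lemma is independent of $\mu\in\mathtt w(\lambda_3)$, where $A=(\mathrm i_{(\lambda_1^1,\lambda_1^2),\lambda_1,k_1}\otimes\mathrm i_{(\lambda_2^1,\lambda_2^2),\lambda_2,k_2})\circ\mathrm i_{(\lambda_1,\lambda_2),\lambda_3,k}:H_{\lambda_3}\to H_{\lambda_1^1}\otimes H_{\lambda_1^2}\otimes H_{\lambda_2^1}\otimes H_{\lambda_2^2}$, $B=(\mathrm i_{(\lambda_1^1,\lambda_2^1),\lambda_3^1,k^1}\otimes\mathrm i_{(\lambda_1^2,\lambda_2^2),\lambda_3^2,k^2})\circ\mathrm i_{(\lambda_3^1,\lambda_3^2),\lambda_3,k_3}:H_{\lambda_3}\to H_{\lambda_1^1}\otimes H_{\lambda_2^1}\otimes H_{\lambda_1^2}\otimes H_{\lambda_2^2}$, and $\Pi$ is the unitary exchanging the two middle tensor factors. *)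

theory Defs
  imports
    "HOL-Analysis.Derivative"
    "HOL-Analysis.Abstract_Topological_Spaces"
    "Jordan_Normal_Form.Spectral_Radius"
begin

section \<open>Compact Lie groups\<close>

text \<open>The recursion asks for total differentiability and for all directional derivatives to be
  of class one less, which on open sets of finite-dimensional spaces is the usual $C^k$.\<close>

primrec Ck_on :: "nat \<Rightarrow> ('a::real_normed_vector \<Rightarrow> 'b::real_normed_vector) \<Rightarrow> 'a set \<Rightarrow> bool"
  where
    "Ck_on 0 f S \<longleftrightarrow> continuous_on S f"
  | "Ck_on (Suc k) f S \<longleftrightarrow>
       (\<forall>x\<in>S. f differentiable (at x)) \<and>
       (\<forall>v. Ck_on k (\<lambda>x. frechet_derivative f (at x) v) S)"

definition smooth_on :: "('a::real_normed_vector \<Rightarrow> 'b::real_normed_vector) \<Rightarrow> 'a set \<Rightarrow> bool"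
  where "smooth_on f S \<longleftrightarrow> open S \<and> (\<forall>k. Ck_on k f S)"

text \<open>The model space \<open>'e\<close> of the charts is a finite-dimensional real normed space rather than a
  type of class \<open>euclidean_space\<close>: the latter has positive dimension, which would exclude finite
  groups.\<close>

type_synonym ('g, 'e) chart = "'g set \<times> ('g \<Rightarrow> 'e)"

abbreviation chart_inv :: "('g, 'e) chart \<Rightarrow> 'e \<Rightarrow> 'g"
  where "chart_inv c \<equiv> inv_into (fst c) (snd c)"

abbreviation chart_image :: "('g, 'e) chart \<Rightarrow> 'e set"
  where "chart_image c \<equiv> snd c ` fst c"

record ('g, 'e) lie_group = "'g monoid" +
  lg_topology :: "'g topology"
  lg_atlas :: "('g, 'e) chart set"

definition smooth_manifold :: "'g topology \<Rightarrow> ('g, 'e::real_normed_vector) chart set \<Rightarrow> bool"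
  where "smooth_manifold T \<A> \<longleftrightarrow>
    Hausdorff_space T \<and> second_countable T \<and>
    (\<exists>B::'e set. finite B \<and> span B = UNIV) \<and>
    (\<Union>c\<in>\<A>. fst c) = topspace T \<and>
    (\<forall>c\<in>\<A>. openin T (fst c) \<and> open (chart_image c) \<and>
       homeomorphic_map (subtopology T (fst c)) (top_of_set (chart_image c)) (snd c)) \<and>
    (\<forall>c\<in>\<A>. \<forall>c'\<in>\<A>. smooth_on (\<lambda>x. snd c' (chart_inv c x)) (snd c ` (fst c \<inter> fst c')))"

definition lie_group :: "('g, 'e::real_normed_vector) lie_group \<Rightarrow> bool"
  where "lie_group G \<longleftrightarrow>
    group G \<and> topspace (lg_topology G) = carrier G \<and>
    smooth_manifold (lg_topology G) (lg_atlas G) \<and>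
    continuous_map (prod_topology (lg_topology G) (lg_topology G)) (lg_topology G)
      (\<lambda>(g, h). g \<otimes>\<^bsub>G\<^esub> h) \<and>
    continuous_map (lg_topology G) (lg_topology G) (\<lambda>g. inv\<^bsub>G\<^esub> g) \<and>
    (\<forall>c1\<in>lg_atlas G. \<forall>c2\<in>lg_atlas G. \<forall>c3\<in>lg_atlas G.
       smooth_on (\<lambda>(x, y). snd c3 (chart_inv c1 x \<otimes>\<^bsub>G\<^esub> chart_inv c2 y))
         {(x, y). x \<in> chart_image c1 \<and> y \<in> chart_image c2 \<and>
                  chart_inv c1 x \<otimes>\<^bsub>G\<^esub> chart_inv c2 y \<in> fst c3}) \<and>
    (\<forall>c1\<in>lg_atlas G. \<forall>c2\<in>lg_atlas G.
       smooth_on (\<lambda>x. snd c2 (inv\<^bsub>G\<^esub> chart_inv c1 x))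
         {x \<in> chart_image c1. inv\<^bsub>G\<^esub> chart_inv c1 x \<in> fst c2})"

definition compact_lie_group :: "('g, 'e::real_normed_vector) lie_group \<Rightarrow> bool"
  where "compact_lie_group G \<longleftrightarrow> lie_group G \<and> compact_space (lg_topology G)"

section \<open>Lie algebra and Cartan subalgebras\<close>

text \<open>A chart \<open>c\<close> around the unit identifies the tangent space at the unit, and hence the Lie
  algebra, with the model space \<open>'e\<close>. The bracket is the derivative of the adjoint
  representation, $[X,Y] = \mathrm{ad}(X)\,Y = (d\,\mathrm{Ad})_1(X)\,Y$.\<close>

definition lie_Ad :: "('g, 'e::real_normed_vector) lie_group \<Rightarrow> ('g, 'e) chart \<Rightarrow> 'g \<Rightarrow> 'e \<Rightarrow> 'e"
  where "lie_Ad G c g Y =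
    frechet_derivative (\<lambda>y. snd c (g \<otimes>\<^bsub>G\<^esub> chart_inv c y \<otimes>\<^bsub>G\<^esub> inv\<^bsub>G\<^esub> g)) (at (snd c \<one>\<^bsub>G\<^esub>)) Y"

definition lie_bracket :: "('g, 'e::real_normed_vector) lie_group \<Rightarrow> ('g, 'e) chart \<Rightarrow> 'e \<Rightarrow> 'e \<Rightarrow> 'e"
  where "lie_bracket G c X Y =
    frechet_derivative (\<lambda>x. lie_Ad G c (chart_inv c x) Y) (at (snd c \<one>\<^bsub>G\<^esub>)) X"

primrec lower_central :: "('e::real_vector \<Rightarrow> 'e \<Rightarrow> 'e) \<Rightarrow> 'e set \<Rightarrow> nat \<Rightarrow> 'e set"
  where
    "lower_central br \<tt> 0 = \<tt>"
  | "lower_central br \<tt> (Suc n) = span {br X Y | X Y. X \<in> \<tt> \<and> Y \<in> lower_central br \<tt> n}"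

text \<open>Nilpotent and self-normalising; in the Lie algebra of a compact group these are the maximal
  abelian subalgebras.\<close>

definition cartan_subalgebra ::
    "('g, 'e::real_normed_vector) lie_group \<Rightarrow> ('g, 'e) chart \<Rightarrow> 'e set \<Rightarrow> bool"
  where "cartan_subalgebra G c \<tt> \<longleftrightarrow>
    real_vector.subspace \<tt> \<and>
    (\<forall>X\<in>\<tt>. \<forall>Y\<in>\<tt>. lie_bracket G c X Y \<in> \<tt>) \<and>
    (\<exists>n. lower_central (lie_bracket G c) \<tt> n = {0}) \<and>
    {X. \<forall>Y\<in>\<tt>. lie_bracket G c X Y \<in> \<tt>} = \<tt>"

section \<open>Finite-dimensional representations\<close>

text \<open>A representation on $\mathbb{C}^n$ is the pair of \<open>n\<close> and the matrix-valued homomorphism;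
  every finite-dimensional representation is isomorphic to one of these. The standard inner
  product is \<open>v \<bullet>c w\<close>, which is conjugate-linear in the second argument, so that
  $\langle x|y\rangle$ is \<open>y \<bullet>c x\<close>.\<close>

type_synonym 'g rep = "nat \<times> ('g \<Rightarrow> complex mat)"

definition smooth_fun :: "('g, 'e::real_normed_vector) lie_group \<Rightarrow> ('g \<Rightarrow> complex) \<Rightarrow> bool"
  where "smooth_fun G f \<longleftrightarrow> (\<forall>c\<in>lg_atlas G. smooth_on (\<lambda>x. f (chart_inv c x)) (chart_image c))"

definition is_rep :: "('g, 'e::real_normed_vector) lie_group \<Rightarrow> 'g rep \<Rightarrow> bool"
  where "is_rep G R \<longleftrightarrow> (case R of (n, D) \<Rightarrow>
    (\<forall>g\<in>carrier G. D g \<in> carrier_mat n n) \<and>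
    D \<one>\<^bsub>G\<^esub> = 1\<^sub>m n \<and>
    (\<forall>g\<in>carrier G. \<forall>h\<in>carrier G. D (g \<otimes>\<^bsub>G\<^esub> h) = D g * D h) \<and>
    (\<forall>i<n. \<forall>j<n. smooth_fun G (\<lambda>g. D g $$ (i, j))))"

definition irreducible_rep :: "('g, 'e::real_normed_vector) lie_group \<Rightarrow> 'g rep \<Rightarrow> bool"
  where "irreducible_rep G R \<longleftrightarrow> (case R of (n, D) \<Rightarrow>
    is_rep G R \<and> n > 0 \<and>
    (\<forall>W. VectorSpace.subspace class_ring W (module_vec TYPE(complex) n) \<and>
         (\<forall>g\<in>carrier G. \<forall>w\<in>W. D g *\<^sub>v w \<in> W)
         \<longrightarrow> W = {0\<^sub>v n} \<or> W = carrier_vec n))"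

definition unitary_mat :: "complex mat \<Rightarrow> bool"
  where "unitary_mat U \<longleftrightarrow> square_mat U \<and> inverts_mat U (mat_adjoint U) \<and> inverts_mat (mat_adjoint U) U"

definition unitary_rep :: "('g, 'e::real_normed_vector) lie_group \<Rightarrow> 'g rep \<Rightarrow> bool"
  where "unitary_rep G R \<longleftrightarrow> is_rep G R \<and> (\<forall>g\<in>carrier G. unitary_mat (snd R g))"

definition rep_iso :: "('g, 'e::real_normed_vector) lie_group \<Rightarrow> 'g rep \<Rightarrow> 'g rep \<Rightarrow> bool"
  where "rep_iso G R R' \<longleftrightarrow> fst R = fst R' \<and>
    (\<exists>P\<in>carrier_mat (fst R) (fst R). invertible_mat P \<and>
       (\<forall>g\<in>carrier G. P * snd R g = snd R' g * P))"

definition irreps :: "('g, 'e::real_normed_vector) lie_group \<Rightarrow> 'g rep set"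
  where "irreps G = {R. irreducible_rep G R}"

definition irrep_iso_rel :: "('g, 'e::real_normed_vector) lie_group \<Rightarrow> ('g rep \<times> 'g rep) set"
  where "irrep_iso_rel G = {(R, R'). R \<in> irreps G \<and> R' \<in> irreps G \<and> rep_iso G R R'}"

definition irrep_classes :: "('g, 'e::real_normed_vector) lie_group \<Rightarrow> 'g rep set set"
  where "irrep_classes G = irreps G // irrep_iso_rel G"

definition kron :: "complex mat \<Rightarrow> complex mat \<Rightarrow> complex mat" (infixr \<open>\<otimes>\<^sub>m\<close> 75)
  where "A \<otimes>\<^sub>m B = mat (dim_row A * dim_row B) (dim_col A * dim_col B)
    (\<lambda>(i, j). A $$ (i div dim_row B, j div dim_col B) * B $$ (i mod dim_row B, j mod dim_col B))"

definition kron_vec :: "complex vec \<Rightarrow> complex vec \<Rightarrow> complex vec" (infixr \<open>\<otimes>\<^sub>v\<close> 75)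
  where "v \<otimes>\<^sub>v w = vec (dim_vec v * dim_vec w) (\<lambda>i. v $ (i div dim_vec w) * w $ (i mod dim_vec w))"

definition tensor_rep :: "'g rep \<Rightarrow> 'g rep \<Rightarrow> 'g rep"
  where "tensor_rep R R' = (fst R * fst R', \<lambda>g. snd R g \<otimes>\<^sub>m snd R' g)"

definition dsum_rep :: "'g rep list \<Rightarrow> 'g rep"
  where "dsum_rep Rs = (sum_list (map fst Rs), \<lambda>g. diag_block_mat (map (\<lambda>R. snd R g) Rs))"

text \<open>Number of summands isomorphic to \<open>R\<close> in a decomposition of \<open>S\<close> into irreducibles; it does
  not depend on the decomposition.\<close>

definition rep_mult :: "('g, 'e::real_normed_vector) lie_group \<Rightarrow> 'g rep \<Rightarrow> 'g rep \<Rightarrow> nat"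
  where "rep_mult G R S = (THE m. \<exists>Rs. set Rs \<subseteq> irreps G \<and> rep_iso G S (dsum_rep Rs) \<and>
    m = length (filter (rep_iso G R) Rs))"

section \<open>Weights\<close>

text \<open>The induced representation of the Lie algebra.\<close>

definition rep_diff ::
    "('g, 'e::real_normed_vector) lie_group \<Rightarrow> ('g, 'e) chart \<Rightarrow> 'g rep \<Rightarrow> 'e \<Rightarrow> complex mat"
  where "rep_diff G c R X = mat (fst R) (fst R)
    (\<lambda>(i, j). frechet_derivative (\<lambda>x. snd R (chart_inv c x) $$ (i, j)) (at (snd c \<one>\<^bsub>G\<^esub>)) X)"

text \<open>Functionals on the Cartan subalgebra \<open>\<tt>\<close> are functions on the whole Lie algebra that vanish
  outside \<open>\<tt>\<close>. No factor of the imaginary unit is split off, so the weights of unitary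
  representations take imaginary values. Real-linearity on \<open>\<tt>\<close> need not be demanded: the
  existence of a nonzero weight vector forces it.\<close>

type_synonym 'e weight = "'e \<Rightarrow> complex"

definition weight_add :: "'e weight \<Rightarrow> 'e weight \<Rightarrow> 'e weight" (infixl \<open>+\<^sub>w\<close> 65)
  where "\<alpha> +\<^sub>w \<beta> = (\<lambda>X. \<alpha> X + \<beta> X)"

definition weight_space ::
    "('g, 'e::real_normed_vector) lie_group \<Rightarrow> ('g, 'e) chart \<Rightarrow> 'e set \<Rightarrow> 'g rep \<Rightarrow> 'e weight
     \<Rightarrow> complex vec set"
  where "weight_space G c \<tt> R \<alpha> =
    {v \<in> carrier_vec (fst R). \<forall>X\<in>\<tt>. rep_diff G c R X *\<^sub>v v = \<alpha> X \<cdot>\<^sub>v v}"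

definition rep_weight ::
    "('g, 'e::real_normed_vector) lie_group \<Rightarrow> ('g, 'e) chart \<Rightarrow> 'e set \<Rightarrow> 'g rep \<Rightarrow> 'e weight \<Rightarrow> bool"
  where "rep_weight G c \<tt> R \<alpha> \<longleftrightarrow>
    (\<forall>X. X \<notin> \<tt> \<longrightarrow> \<alpha> X = 0) \<and> weight_space G c \<tt> R \<alpha> \<noteq> {0\<^sub>v (fst R)}"

definition weight_mult ::
    "('g, 'e::real_normed_vector) lie_group \<Rightarrow> ('g, 'e) chart \<Rightarrow> 'e set \<Rightarrow> 'g rep \<Rightarrow> 'e weight \<Rightarrow> nat"
  where "weight_mult G c \<tt> R \<alpha> = vectorspace.dim class_ring
    ((module_vec TYPE(complex) (fst R))\<lparr>carrier := weight_space G c \<tt> R \<alpha>\<rparr>)"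

section \<open>The fixed data\<close>

text \<open>\<open>labels\<close> is the set of labels of the isomorphism classes of irreps and \<open>irr\<close> gives the
  representation \<open>(n, D)\<close> chosen for each label, \<open>id_chart\<close> is the chart used to identify the Lie
  algebra with \<open>'e\<close>, and \<open>ket l \<mu>\<close> is the weight basis vector. The direct sum over the pairs
  \<open>(l, k)\<close> is realised as a block sum, for which these pairs are listed in some order by
  \<open>summands\<close>; \<open>cg_iso l1 l2\<close> is the matrix of the isomorphism from the tensor product to it.\<close>

type_synonym 'e wlabel = "'e weight \<times> nat"

record ('g, 'e, 'l) rep_data =
  labels :: "'l set"
  irr :: "'l \<Rightarrow> 'g rep"
  id_chart :: "('g, 'e) chart"
  cartan :: "'e set"
  ket :: "'l \<Rightarrow> 'e wlabel \<Rightarrow> complex vec"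
  summands :: "'l \<Rightarrow> 'l \<Rightarrow> ('l \<times> nat) list"
  cg_iso :: "'l \<Rightarrow> 'l \<Rightarrow> complex mat"

abbreviation ldim :: "('g, 'e, 'l) rep_data \<Rightarrow> 'l \<Rightarrow> nat"
  where "ldim S l \<equiv> fst (irr S l)"

definition is_wt ::
    "('g, 'e::real_normed_vector) lie_group \<Rightarrow> ('g, 'e, 'l) rep_data \<Rightarrow> 'l \<Rightarrow> 'e weight \<Rightarrow> bool"
  where "is_wt G S l \<alpha> \<longleftrightarrow> rep_weight G (id_chart S) (cartan S) (irr S l) \<alpha>"

definition wt_mult ::
    "('g, 'e::real_normed_vector) lie_group \<Rightarrow> ('g, 'e, 'l) rep_data \<Rightarrow> 'l \<Rightarrow> 'e weight \<Rightarrow> nat"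
  where "wt_mult G S l \<alpha> = weight_mult G (id_chart S) (cartan S) (irr S l) \<alpha>"

definition wlabels ::
    "('g, 'e::real_normed_vector) lie_group \<Rightarrow> ('g, 'e, 'l) rep_data \<Rightarrow> 'l \<Rightarrow> 'e wlabel set"
  where "wlabels G S l = {(\<alpha>, a). is_wt G S l \<alpha> \<and> 1 \<le> a \<and> a \<le> wt_mult G S l \<alpha>}"

definition tensor_mult ::
    "('g, 'e::real_normed_vector) lie_group \<Rightarrow> ('g, 'e, 'l) rep_data \<Rightarrow> 'l \<Rightarrow> 'l \<Rightarrow> 'l \<Rightarrow> nat"
  where "tensor_mult G S l1 l2 l = rep_mult G (irr S l) (tensor_rep (irr S l1) (irr S l2))"

definition cg_pairs ::
    "('g, 'e::real_normed_vector) lie_group \<Rightarrow> ('g, 'e, 'l) rep_data \<Rightarrow> 'l \<Rightarrow> 'l \<Rightarrow> ('l \<times> nat) set"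
  where "cg_pairs G S l1 l2 = {(l, k). l \<in> labels S \<and>
    tensor_mult G S l1 l2 l > 0 \<and> 1 \<le> k \<and> k \<le> tensor_mult G S l1 l2 l}"

definition orthonormal_weight_basis ::
    "('g, 'e::real_normed_vector) lie_group \<Rightarrow> ('g, 'e, 'l) rep_data \<Rightarrow> 'l \<Rightarrow> bool"
  where "orthonormal_weight_basis G S l \<longleftrightarrow>
    (\<forall>\<mu>\<in>wlabels G S l. ket S l \<mu> \<in> weight_space G (id_chart S) (cartan S) (irr S l) (fst \<mu>)) \<and>
    (\<forall>\<mu>\<in>wlabels G S l. \<forall>\<nu>\<in>wlabels G S l. ket S l \<mu> \<bullet>c ket S l \<nu> = (if \<mu> = \<nu> then 1 else 0)) \<and>
    vectorspace.basis class_ring (module_vec TYPE(complex) (ldim S l)) (ket S l ` wlabels G S l)"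

definition unitary_cg_iso ::
    "('g, 'e::real_normed_vector) lie_group \<Rightarrow> ('g, 'e, 'l) rep_data \<Rightarrow> 'l \<Rightarrow> 'l \<Rightarrow> bool"
  where "unitary_cg_iso G S l1 l2 \<longleftrightarrow>
    (let T = tensor_rep (irr S l1) (irr S l2);
         D = dsum_rep (map (\<lambda>(l, k). irr S l) (summands S l1 l2));
         U = cg_iso S l1 l2
     in distinct (summands S l1 l2) \<and> set (summands S l1 l2) = cg_pairs G S l1 l2 \<and>
        U \<in> carrier_mat (fst D) (fst T) \<and> unitary_mat U \<and>
        (\<forall>g\<in>carrier G. U * snd T g = snd D g * U))"

definition rep_setting ::
    "('g, 'e::real_normed_vector) lie_group \<Rightarrow> ('g, 'e, 'l) rep_data \<Rightarrow> bool"
  where "rep_setting G S \<longleftrightarrow>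
    bij_betw (\<lambda>l. irrep_iso_rel G `` {irr S l}) (labels S) (irrep_classes G) \<and>
    (\<forall>l\<in>labels S. irreducible_rep G (irr S l) \<and> unitary_rep G (irr S l)) \<and>
    id_chart S \<in> lg_atlas G \<and> \<one>\<^bsub>G\<^esub> \<in> fst (id_chart S) \<and>
    cartan_subalgebra G (id_chart S) (cartan S) \<and>
    (\<forall>l\<in>labels S. orthonormal_weight_basis G S l) \<and>
    (\<forall>l1\<in>labels S. \<forall>l2\<in>labels S. unitary_cg_iso G S l1 l2)"

section \<open>Clebsch--Gordan coefficients and the recoupling coefficient\<close>

text \<open>\<open>block_inj S xs x\<close> is the canonical injection of the summand \<open>x\<close> into the block sum over
  \<open>xs\<close>; \<open>inj_i\<close> is its composition with the inverse of the unitary \<open>cg_iso\<close>.\<close>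

definition block_inj :: "('g, 'e, 'l) rep_data \<Rightarrow> ('l \<times> nat) list \<Rightarrow> 'l \<times> nat \<Rightarrow> complex mat"
  where "block_inj S xs x =
    (let dims = map (\<lambda>y. ldim S (fst y));
         offset = sum_list (dims (takeWhile (\<lambda>y. y \<noteq> x) xs))
     in mat (sum_list (dims xs)) (ldim S (fst x)) (\<lambda>(r, c). if r = offset + c then 1 else 0))"

definition inj_i :: "('g, 'e, 'l) rep_data \<Rightarrow> 'l \<Rightarrow> 'l \<Rightarrow> 'l \<Rightarrow> nat \<Rightarrow> complex mat"
  where "inj_i S l1 l2 l k =
    mat_adjoint (cg_iso S l1 l2) * block_inj S (summands S l1 l2) (l, k)"

definition CG ::
    "('g, 'e, 'l) rep_data \<Rightarrow> 'l \<Rightarrow> 'l \<Rightarrow> 'l \<Rightarrow> nat \<Rightarrow> 'e wlabel \<Rightarrow> 'e wlabel \<Rightarrow> 'e wlabel \<Rightarrow> complex"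
  where "CG S l1 l2 l k \<mu>1 \<mu>2 \<mu> =
    (inj_i S l1 l2 l k *\<^sub>v ket S l \<mu>) \<bullet>c (ket S l1 \<mu>1 \<otimes>\<^sub>v ket S l2 \<mu>2)"

text \<open>\<open>flip m n\<close> maps \<open>v \<otimes>\<^sub>v w\<close> to \<open>w \<otimes>\<^sub>v v\<close> for \<open>v\<close>, \<open>w\<close> of dimension \<open>m\<close>, \<open>n\<close>.\<close>

definition flip :: "nat \<Rightarrow> nat \<Rightarrow> complex mat"
  where "flip m n = mat (n * m) (m * n)
    (\<lambda>(r, c). if r div m = c mod n \<and> r mod m = c div n then 1 else 0)"

definition middle_flip :: "nat \<Rightarrow> nat \<Rightarrow> nat \<Rightarrow> nat \<Rightarrow> complex mat"
  where "middle_flip a b c d = 1\<^sub>m a \<otimes>\<^sub>m flip b c \<otimes>\<^sub>m 1\<^sub>m d"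

text \<open>The arguments are the rows of the \<open>4 \<times> 4\<close> array, its first three rows being
  \<open>l11 l12 l1 k1\<close>, \<open>l21 l22 l2 k2\<close>, \<open>l31 l32 l3 k3\<close>, and its last row
  $(k^1, k^2, k)$ being \<open>ku1 ku2 k\<close>. The value is the common value of the diagonal matrix elements
  of $A^* \Pi B$.\<close>

definition nine_lambda ::
    "('g, 'e::real_normed_vector) lie_group \<Rightarrow> ('g, 'e, 'l) rep_data
     \<Rightarrow> 'l \<Rightarrow> 'l \<Rightarrow> 'l \<Rightarrow> nat \<Rightarrow> 'l \<Rightarrow> 'l \<Rightarrow> 'l \<Rightarrow> nat \<Rightarrow> 'l \<Rightarrow> 'l \<Rightarrow> 'l \<Rightarrow> nat
     \<Rightarrow> nat \<Rightarrow> nat \<Rightarrow> nat \<Rightarrow> complex"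
  where "nine_lambda G S l11 l12 l1 k1 l21 l22 l2 k2 l31 l32 l3 k3 ku1 ku2 k =
    (let A = (inj_i S l11 l12 l1 k1 \<otimes>\<^sub>m inj_i S l21 l22 l2 k2) * inj_i S l1 l2 l3 k;
         B = (inj_i S l11 l21 l31 ku1 \<otimes>\<^sub>m inj_i S l12 l22 l32 ku2) * inj_i S l31 l32 l3 k3;
         P = middle_flip (ldim S l11) (ldim S l21) (ldim S l12) (ldim S l22)
     in THE z. \<forall>\<mu>\<in>wlabels G S l3.
          z = ((mat_adjoint A * P * B) *\<^sub>v ket S l3 \<mu>) \<bullet>c ket S l3 \<mu>)"

end

theory Submission
  imports Defs
begin

text \<open>The operators \<open>A\<close>, \<open>B\<close> and the flip intertwine unitary representations, so by Schur's lemma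
  $A^* \Pi B$ is a scalar and its value can be read off at the given weight vector. Inserting the
  resolution of the identity by the product weight basis between $A^*$ and $\Pi B$, and then by
  the weight bases of the intermediate irreps inside \<open>A\<close> and \<open>B\<close>, gives the unrestricted sum.

  For the restricted sums, differentiate the intertwining relation of the adjoint injection
  $\mathrm{i}^*$ at the unit: it sends a product of weight vectors into the weight space of the sum
  of the two weights. Hence a Clebsch--Gordan coefficient vanishes unless the weights add up.\<close>

text \<open>All tensor products are taken in coordinates: the pair (i, j) becomes the index
  \<open>i * b + j\<close>. In this mixed-radix encoding the Kronecker product is strictly
  associative, so regrouping four factors needs no associator, and every operator identity can be
  tested on product vectors. Irreducibility enters at one place. \<open>nine_lambda\<close> is a
  definite description over all weight labels, and it is Schur's lemma that makes it denote the
  matrix element at any one of them; the unrestricted formula is then linear algebra. What this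
  linear algebra uses of a basis is its completeness relation, which passes to tensor products at
  once. For the restrictions, the point is that weights are functions vanishing outside the Cartan
  subalgebra. Two different sums of weights therefore differ at some X inside it, and the
  eigenvalues of this single X already force the coefficient to be zero.\<close>

section \<open>Index arithmetic for pairs of coordinates\<close>

lemma sum_lessThan_times:
  fixes f :: "nat \<Rightarrow> 'a::comm_monoid_add"
  shows "(\<Sum>p<n * m. f p) = (\<Sum>i<n. \<Sum>j<m. f (i * m + j))"
proof -
  have "(\<Sum>j = i * m..<i * m + m. f j) = (\<Sum>j<m. f (i * m + j))" for i
    using sum.shift_bounds_nat_ivl[of f 0 "i * m" m] by (simp add: lessThan_atLeast0 add.commute)
  then show ?thesis
    by (simp flip: sum.nat_group)
qed

lemma mult_add_less:
  fixes i j n m :: nat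
  assumes "i < n" "j < m"
  shows "i * m + j < n * m"
proof -
  have "i * m + j < Suc i * m" using assms by simp
  also have "\<dots> \<le> n * m" using assms by (intro mult_right_mono) auto
  finally show ?thesis .
qed

lemma div_mod_less:
  fixes p n m :: nat
  assumes "p < n * m"
  shows "p div m < n" "p mod m < m"
proof -
  have "m > 0" using assms by (cases m) auto
  then show "p div m < n" "p mod m < m"
    using assms by (simp_all add: less_mult_imp_div_less)
qed

section \<open>Coordinates, adjoints and the complex inner product\<close>

lemma cscalar_prod_sum:
  fixes v w :: "complex vec"
  assumes "w \<in> carrier_vec n"
  shows "v \<bullet>c w = (\<Sum>i<n. v $ i * cnj (w $ i))"
  using assms by (auto simp: scalar_prod_def lessThan_atLeast0 intro!: sum.cong)

lemma mult_mat_vec_index: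
  fixes A :: "complex mat"
  assumes "A \<in> carrier_mat n m" "v \<in> carrier_vec m" "i < n"
  shows "(A *\<^sub>v v) $ i = (\<Sum>j<m. A $$ (i, j) * v $ j)"
  using assms by (auto simp: scalar_prod_def lessThan_atLeast0 intro!: sum.cong)

lemma mult_mat_index:
  fixes A :: "complex mat"
  assumes "A \<in> carrier_mat n m" "B \<in> carrier_mat m l" "i < n" "j < l"
  shows "(A * B) $$ (i, j) = (\<Sum>k<m. A $$ (i, k) * B $$ (k, j))"
  using assms by (auto simp: scalar_prod_def lessThan_atLeast0 intro!: sum.cong)

lemma mat_adjoint_carrier [intro]:
  "A \<in> carrier_mat n m \<Longrightarrow> mat_adjoint A \<in> carrier_mat m n"
  by (auto simp: mat_adjoint_def mat_of_rows_def)

lemma mat_adjoint_index: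
  fixes A :: "complex mat"
  assumes "A \<in> carrier_mat n m" "i < m" "j < n"
  shows "mat_adjoint A $$ (i, j) = cnj (A $$ (j, i))"
  using assms by (auto simp: mat_adjoint_def mat_of_rows_index)

lemma mat_adjoint_mat_adjoint:
  fixes A :: "complex mat"
  assumes "A \<in> carrier_mat n m"
  shows "mat_adjoint (mat_adjoint A) = A"
proof (rule eq_matI)
  note c = assms mat_adjoint_carrier[OF assms] mat_adjoint_carrier[OF mat_adjoint_carrier[OF assms]]
  show "dim_row (mat_adjoint (mat_adjoint A)) = dim_row A"
    "dim_col (mat_adjoint (mat_adjoint A)) = dim_col A" using c by auto
  fix i j assume "i < dim_row A" "j < dim_col A"
  then show "mat_adjoint (mat_adjoint A) $$ (i, j) = A $$ (i, j)"
    using assms by (simp add: mat_adjoint_index[OF c(2)] mat_adjoint_index[OF assms])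
qed

lemma mat_adjoint_mult:
  fixes A B :: "complex mat"
  assumes A: "A \<in> carrier_mat n m" and B: "B \<in> carrier_mat m l"
  shows "mat_adjoint (A * B) = mat_adjoint B * mat_adjoint A"
proof (rule eq_matI)
  have AB: "A * B \<in> carrier_mat n l" using assms by auto
  note c = mat_adjoint_carrier[OF A] mat_adjoint_carrier[OF B] mat_adjoint_carrier[OF AB]
  show "dim_row (mat_adjoint (A * B)) = dim_row (mat_adjoint B * mat_adjoint A)"
    "dim_col (mat_adjoint (A * B)) = dim_col (mat_adjoint B * mat_adjoint A)" using c by auto
  fix i j assume "i < dim_row (mat_adjoint B * mat_adjoint A)" "j < dim_col (mat_adjoint B * mat_adjoint A)"
  then have ij: "i < l" "j < n" using c by auto
  show "mat_adjoint (A * B) $$ (i, j) = (mat_adjoint B * mat_adjoint A) $$ (i, j)"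
    unfolding mat_adjoint_index[OF AB ij] mult_mat_index[OF A B ij(2,1)]
      mult_mat_index[OF c(2,1) ij]
    using ij by (auto simp: mat_adjoint_index[OF A] mat_adjoint_index[OF B] mult.commute
        intro!: sum.cong)
qed

lemma cscalar_prod_adjoint:
  fixes A :: "complex mat"
  assumes A: "A \<in> carrier_mat n m" and v: "v \<in> carrier_vec m" and w: "w \<in> carrier_vec n"
  shows "(A *\<^sub>v v) \<bullet>c w = v \<bullet>c (mat_adjoint A *\<^sub>v w)"
proof -
  note A' = mat_adjoint_carrier[OF A]
  have "(A *\<^sub>v v) \<bullet>c w = (\<Sum>i<n. (\<Sum>j<m. A $$ (i, j) * v $ j) * cnj (w $ i))"
    by (simp add: cscalar_prod_sum[OF w] mult_mat_vec_index[OF A v] del: index_mult_mat_vec)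
  also have "\<dots> = (\<Sum>j<m. \<Sum>i<n. A $$ (i, j) * v $ j * cnj (w $ i))"
    by (simp add: sum_distrib_right) (rule sum.swap)
  also have "\<dots> = (\<Sum>j<m. v $ j * cnj (\<Sum>i<n. mat_adjoint A $$ (j, i) * w $ i))"
  proof (intro sum.cong refl)
    fix j assume "j \<in> {..<m}"
    then have "cnj (mat_adjoint A $$ (j, i)) = A $$ (i, j)" if "i < n" for i
      using that by (simp add: mat_adjoint_index[OF A])
    then show "(\<Sum>i<n. A $$ (i, j) * v $ j * cnj (w $ i))
        = v $ j * cnj (\<Sum>i<n. mat_adjoint A $$ (j, i) * w $ i)"
      by (simp add: sum_distrib_left) (simp add: mult_ac)
  qed
  also have "\<dots> = (\<Sum>j<m. v $ j * cnj ((mat_adjoint A *\<^sub>v w) $ j))"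
    by (simp add: mult_mat_vec_index[OF A' w] del: index_mult_mat_vec)
  also have "\<dots> = v \<bullet>c (mat_adjoint A *\<^sub>v w)"
    by (simp only: cscalar_prod_sum[OF mult_mat_vec_carrier[OF A' w]])
  finally show ?thesis .
qed

lemma cscalar_prod_adjoint':
  fixes A :: "complex mat"
  assumes A: "A \<in> carrier_mat n m" and v: "v \<in> carrier_vec n" and w: "w \<in> carrier_vec m"
  shows "(mat_adjoint A *\<^sub>v v) \<bullet>c w = v \<bullet>c (A *\<^sub>v w)"
  using cscalar_prod_adjoint[OF mat_adjoint_carrier[OF A] v w] mat_adjoint_mat_adjoint[OF A] by simp

lemma cnj_cscalar_prod:
  fixes v w :: "complex vec"
  assumes "v \<in> carrier_vec n" "w \<in> carrier_vec n"
  shows "cnj (v \<bullet>c w) = w \<bullet>c v"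
  using assms by (simp add: cscalar_prod_sum mult.commute)

section \<open>Kronecker products\<close>

lemma kron_carrier [intro]:
  "A \<in> carrier_mat a b \<Longrightarrow> B \<in> carrier_mat c d \<Longrightarrow> A \<otimes>\<^sub>m B \<in> carrier_mat (a * c) (b * d)"
  by (simp add: kron_def)

lemma kron_vec_carrier [intro]:
  "v \<in> carrier_vec a \<Longrightarrow> w \<in> carrier_vec b \<Longrightarrow> v \<otimes>\<^sub>v w \<in> carrier_vec (a * b)"
  unfolding kron_vec_def by (rule carrier_vecI) (simp only: dim_vec carrier_vecD)

lemma kron_vec_index:
  assumes "v \<in> carrier_vec a" "w \<in> carrier_vec b" "i < a" "j < b"
  shows "(v \<otimes>\<^sub>v w) $ (i * b + j) = v $ i * w $ j"
  using assms mult_add_less[OF assms(3,4)] by (simp add: kron_vec_def)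

lemma kron_index:
  assumes "A \<in> carrier_mat a b" "B \<in> carrier_mat c d" "i < a" "j < c" "k < b" "l < d"
  shows "(A \<otimes>\<^sub>m B) $$ (i * c + j, k * d + l) = A $$ (i, k) * B $$ (j, l)"
  using assms mult_add_less[OF assms(3,4)] mult_add_less[OF assms(5,6)] by (simp add: kron_def)

text \<open>The scheme for equations in a tensor product: every index below \<open>a * b\<close>
  splits by division with remainder, and at split indices \<open>kron_vec_index\<close> can compute
  the entries.\<close>

lemma eq_vec_timesI:
  fixes v w :: "complex vec"
  assumes v: "v \<in> carrier_vec (a * b)" and w: "w \<in> carrier_vec (a * b)"
    and eq: "\<And>i j. i < a \<Longrightarrow> j < b \<Longrightarrow> v $ (i * b + j) = w $ (i * b + j)"
  shows "v = w"
proof (rule eq_vecI)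
  show "dim_vec v = dim_vec w" using v w by auto
  fix p assume "p < dim_vec w"
  then have "p < a * b" using w by auto
  from eq[OF div_mod_less[OF this]] show "v $ p = w $ p" by simp
qed

text \<open>At a split index the matrix-vector product is a double sum whose summand is a function
  of k times a function of l, so it factors into two single sums.\<close>

lemma kron_mult_kron_vec:
  assumes A: "A \<in> carrier_mat a b" and B: "B \<in> carrier_mat c d"
    and v: "v \<in> carrier_vec b" and w: "w \<in> carrier_vec d"
  shows "(A \<otimes>\<^sub>m B) *\<^sub>v (v \<otimes>\<^sub>v w) = (A *\<^sub>v v) \<otimes>\<^sub>v (B *\<^sub>v w)"
proof (rule eq_vec_timesI)
  note AB = kron_carrier[OF A B] and vw = kron_vec_carrier[OF v w]
  have Av: "A *\<^sub>v v \<in> carrier_vec a" and Bw: "B *\<^sub>v w \<in> carrier_vec c" using A B v w by auto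
  show "(A \<otimes>\<^sub>m B) *\<^sub>v (v \<otimes>\<^sub>v w) \<in> carrier_vec (a * c)" using AB vw by auto
  show "(A *\<^sub>v v) \<otimes>\<^sub>v (B *\<^sub>v w) \<in> carrier_vec (a * c)" using Av Bw by auto
  fix i j assume ij: "i < a" "j < c"
  have "((A \<otimes>\<^sub>m B) *\<^sub>v (v \<otimes>\<^sub>v w)) $ (i * c + j)
      = (\<Sum>k<b. \<Sum>l<d. (A $$ (i, k) * v $ k) * (B $$ (j, l) * w $ l))"
    unfolding mult_mat_vec_index[OF AB vw mult_add_less[OF ij]] sum_lessThan_times
    by (auto simp: kron_index[OF A B ij] kron_vec_index[OF v w] intro!: sum.cong)
  also have "\<dots> = (A *\<^sub>v v) $ i * (B *\<^sub>v w) $ j"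
    unfolding mult_mat_vec_index[OF A v ij(1)] mult_mat_vec_index[OF B w ij(2)] sum_product ..
  finally show "((A \<otimes>\<^sub>m B) *\<^sub>v (v \<otimes>\<^sub>v w)) $ (i * c + j) = ((A *\<^sub>v v) \<otimes>\<^sub>v (B *\<^sub>v w)) $ (i * c + j)"
    by (simp only: kron_vec_index[OF Av Bw ij])
qed

lemma cscalar_prod_kron_vec:
  assumes v: "v \<in> carrier_vec a" and w: "w \<in> carrier_vec b"
    and v': "v' \<in> carrier_vec a" and w': "w' \<in> carrier_vec b"
  shows "(v \<otimes>\<^sub>v w) \<bullet>c (v' \<otimes>\<^sub>v w') = (v \<bullet>c v') * (w \<bullet>c w')"
proof -
  have "(v \<otimes>\<^sub>v w) \<bullet>c (v' \<otimes>\<^sub>v w')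
      = (\<Sum>i<a. \<Sum>j<b. (v $ i * cnj (v' $ i)) * (w $ j * cnj (w' $ j)))"
    unfolding cscalar_prod_sum[OF kron_vec_carrier[OF v' w']] sum_lessThan_times
    by (auto simp: kron_vec_index[OF v w] kron_vec_index[OF v' w'] intro!: sum.cong)
  also have "\<dots> = (v \<bullet>c v') * (w \<bullet>c w')"
    unfolding cscalar_prod_sum[OF v'] cscalar_prod_sum[OF w'] sum_product ..
  finally show ?thesis .
qed

text \<open>This is an equality and not just an isomorphism, because
  \<open>(i * b + j) * c + k\<close> and \<open>i * (b * c) + (j * c + k)\<close> are the same
  number.\<close>

lemma kron_vec_assoc:
  assumes u: "u \<in> carrier_vec a" and v: "v \<in> carrier_vec b" and w: "w \<in> carrier_vec c"
  shows "(u \<otimes>\<^sub>v v) \<otimes>\<^sub>v w = u \<otimes>\<^sub>v (v \<otimes>\<^sub>v w)"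
proof (rule eq_vec_timesI[where a = a and b = "b * c"])
  note uv = kron_vec_carrier[OF u v] and vw = kron_vec_carrier[OF v w]
  show "(u \<otimes>\<^sub>v v) \<otimes>\<^sub>v w \<in> carrier_vec (a * (b * c))"
    using kron_vec_carrier[OF uv w] by (simp add: mult.assoc)
  show "u \<otimes>\<^sub>v (v \<otimes>\<^sub>v w) \<in> carrier_vec (a * (b * c))" by (rule kron_vec_carrier[OF u vw])
  fix i p assume i: "i < a" and p: "p < b * c"
  define j k where "j = p div c" and "k = p mod c"
  have jk: "j < b" "k < c" and p': "p = j * c + k"
    using div_mod_less[OF p] by (auto simp: j_def k_def)
  have "i * (b * c) + p = (i * b + j) * c + k" by (simp add: p' algebra_simps)
  show "((u \<otimes>\<^sub>v v) \<otimes>\<^sub>v w) $ (i * (b * c) + p) = (u \<otimes>\<^sub>v (v \<otimes>\<^sub>v w)) $ (i * (b * c) + p)"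
    unfolding kron_vec_index[OF u vw i p]
    unfolding \<open>i * (b * c) + p = (i * b + j) * c + k\<close>
      kron_vec_index[OF uv w mult_add_less[OF i jk(1)] jk(2)] kron_vec_index[OF u v i jk(1)]
    unfolding p' kron_vec_index[OF v w jk] by (simp only: mult.assoc)
qed

text \<open>Standard basis vectors are product vectors; hence a matrix is determined by its values
  on product vectors, which is what the next criteria exploit.\<close>

lemma unit_vec_kron_vec:
  assumes "p < a * b"
  shows "(unit_vec (a * b) p :: complex vec) = unit_vec a (p div b) \<otimes>\<^sub>v unit_vec b (p mod b)"
proof (rule eq_vec_timesI)
  show "unit_vec (a * b) p \<in> carrier_vec (a * b)"
    "unit_vec a (p div b) \<otimes>\<^sub>v unit_vec b (p mod b) \<in> carrier_vec (a * b)" by auto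
  fix i j assume ij: "i < a" "j < b"
  note p = div_mod_less[OF assms]
  have "i * b + j = p \<longleftrightarrow> i = p div b \<and> j = p mod b"
  proof
    assume "i * b + j = p"
    then have "p = j + i * b" by simp
    then show "i = p div b \<and> j = p mod b" using ij(2) by simp
  qed simp
  then have "(unit_vec (a * b) p :: complex vec) $ (i * b + j) = unit_vec a (p div b) $ i * unit_vec b (p mod b) $ j"
    unfolding index_unit_vec(1)[OF assms mult_add_less[OF ij]] index_unit_vec(1)[OF p(1) ij(1)]
      index_unit_vec(1)[OF p(2) ij(2)] by (simp only: if_True if_False mult_1 mult_zero_left mult_zero_right
        split: if_split) blast
  then show "unit_vec (a * b) p $ (i * b + j)
      = (unit_vec a (p div b) \<otimes>\<^sub>v unit_vec b (p mod b)) $ (i * b + j)"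
    using kron_vec_index[OF unit_vec_carrier unit_vec_carrier ij, of "p div b" "p mod b"] by (rule trans[OF _ sym])
qed

lemma eq_mat_unit_vecI:
  fixes A B :: "complex mat"
  assumes A: "A \<in> carrier_mat n m" and B: "B \<in> carrier_mat n m"
    and eq: "\<And>j. j < m \<Longrightarrow> A *\<^sub>v unit_vec m j = B *\<^sub>v unit_vec m j"
  shows "A = B"
proof (rule eq_matI)
  show "dim_row A = dim_row B" "dim_col A = dim_col B" using A B by auto
  fix i j assume "i < dim_row B" "j < dim_col B"
  then have ij: "i < n" "j < m" using B by auto
  have "(A *\<^sub>v unit_vec m j) $ i = A $$ (i, j)" "(B *\<^sub>v unit_vec m j) $ i = B $$ (i, j)"
    using A B ij by (auto simp: scalar_prod_right_unit)
  then show "A $$ (i, j) = B $$ (i, j)" using eq[OF ij(2)] by simp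
qed

lemma eq_mat_kron_vecI:
  fixes A B :: "complex mat"
  assumes A: "A \<in> carrier_mat n (a * b)" and B: "B \<in> carrier_mat n (a * b)"
    and eq: "\<And>v w. v \<in> carrier_vec a \<Longrightarrow> w \<in> carrier_vec b \<Longrightarrow> A *\<^sub>v (v \<otimes>\<^sub>v w) = B *\<^sub>v (v \<otimes>\<^sub>v w)"
  shows "A = B"
proof (rule eq_mat_unit_vecI[OF A B])
  fix p assume "p < a * b"
  then show "A *\<^sub>v unit_vec (a * b) p = B *\<^sub>v unit_vec (a * b) p"
    unfolding unit_vec_kron_vec[OF \<open>p < a * b\<close>] by (intro eq unit_vec_carrier)
qed

text \<open>The index is split three times: into two halves, and then each half again. This fourfold
  form serves \<open>middle_flip\<close>, whose action is transparent only on products of four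
  vectors.\<close>

lemma eq_mat_kron_vec4I:
  fixes A B :: "complex mat"
  assumes A: "A \<in> carrier_mat n ((a * b) * (c * d))" and B: "B \<in> carrier_mat n ((a * b) * (c * d))"
    and eq: "\<And>u v w x. u \<in> carrier_vec a \<Longrightarrow> v \<in> carrier_vec b \<Longrightarrow> w \<in> carrier_vec c \<Longrightarrow>
      x \<in> carrier_vec d \<Longrightarrow> A *\<^sub>v ((u \<otimes>\<^sub>v v) \<otimes>\<^sub>v (w \<otimes>\<^sub>v x)) = B *\<^sub>v ((u \<otimes>\<^sub>v v) \<otimes>\<^sub>v (w \<otimes>\<^sub>v x))"
  shows "A = B"
proof (rule eq_mat_unit_vecI[OF A B])
  fix p assume p: "p < (a * b) * (c * d)"
  show "A *\<^sub>v unit_vec ((a * b) * (c * d)) p = B *\<^sub>v unit_vec ((a * b) * (c * d)) p"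
    unfolding unit_vec_kron_vec[OF p] unit_vec_kron_vec[OF div_mod_less(1)[OF p]]
      unit_vec_kron_vec[OF div_mod_less(2)[OF p]]
    by (intro eq unit_vec_carrier)
qed

text \<open>The mixed-product rule. On a product vector both sides apply C and then A to the first
  factor, D and then B to the second.\<close>

lemma kron_mult_kron:
  assumes A: "A \<in> carrier_mat a b" and B: "B \<in> carrier_mat c d"
    and C: "C \<in> carrier_mat b e" and D: "D \<in> carrier_mat d f"
  shows "(A \<otimes>\<^sub>m B) * (C \<otimes>\<^sub>m D) = (A * C) \<otimes>\<^sub>m (B * D)"
proof (rule eq_mat_kron_vecI[where a = e and b = f])
  note AB = kron_carrier[OF A B] and CD = kron_carrier[OF C D]
  have AC: "A * C \<in> carrier_mat a e" and BD: "B * D \<in> carrier_mat c f" using A B C D by auto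
  show "(A \<otimes>\<^sub>m B) * (C \<otimes>\<^sub>m D) \<in> carrier_mat (a * c) (e * f)" using AB CD by auto
  show "(A * C) \<otimes>\<^sub>m (B * D) \<in> carrier_mat (a * c) (e * f)" using AC BD by auto
  fix v w :: "complex vec" assume v: "v \<in> carrier_vec e" and w: "w \<in> carrier_vec f"
  have "((A \<otimes>\<^sub>m B) * (C \<otimes>\<^sub>m D)) *\<^sub>v (v \<otimes>\<^sub>v w) = (A \<otimes>\<^sub>m B) *\<^sub>v ((C *\<^sub>v v) \<otimes>\<^sub>v (D *\<^sub>v w))"
    by (simp add: assoc_mult_mat_vec[OF AB CD kron_vec_carrier[OF v w]] kron_mult_kron_vec[OF C D v w])
  also have "\<dots> = (A *\<^sub>v (C *\<^sub>v v)) \<otimes>\<^sub>v (B *\<^sub>v (D *\<^sub>v w))"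
    using C D v w by (intro kron_mult_kron_vec[OF A B]) auto
  also have "\<dots> = ((A * C) \<otimes>\<^sub>m (B * D)) *\<^sub>v (v \<otimes>\<^sub>v w)"
    by (simp add: kron_mult_kron_vec[OF AC BD v w] assoc_mult_mat_vec[OF A C v] assoc_mult_mat_vec[OF B D w])
  finally show "((A \<otimes>\<^sub>m B) * (C \<otimes>\<^sub>m D)) *\<^sub>v (v \<otimes>\<^sub>v w) = ((A * C) \<otimes>\<^sub>m (B * D)) *\<^sub>v (v \<otimes>\<^sub>v w)" .
qed

lemma kron_one: "1\<^sub>m a \<otimes>\<^sub>m 1\<^sub>m b = 1\<^sub>m (a * b)"
proof (rule eq_mat_kron_vecI)
  show "1\<^sub>m a \<otimes>\<^sub>m 1\<^sub>m b \<in> carrier_mat (a * b) (a * b)" "1\<^sub>m (a * b) \<in> carrier_mat (a * b) (a * b)"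
    by auto
  fix v w :: "complex vec" assume v: "v \<in> carrier_vec a" and w: "w \<in> carrier_vec b"
  show "(1\<^sub>m a \<otimes>\<^sub>m 1\<^sub>m b) *\<^sub>v (v \<otimes>\<^sub>v w) = 1\<^sub>m (a * b) *\<^sub>v (v \<otimes>\<^sub>v w)"
    by (subst kron_mult_kron_vec[of _ a a _ b b]) (use v w kron_vec_carrier[OF v w] in auto)
qed

lemma mat_adjoint_kron:
  assumes A: "A \<in> carrier_mat a b" and B: "B \<in> carrier_mat c d"
  shows "mat_adjoint (A \<otimes>\<^sub>m B) = mat_adjoint A \<otimes>\<^sub>m mat_adjoint B"
proof (rule eq_matI)
  note A' = mat_adjoint_carrier[OF A] and B' = mat_adjoint_carrier[OF B]
    and AB = kron_carrier[OF A B]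
  note AB' = mat_adjoint_carrier[OF AB] and A'B' = kron_carrier[OF A' B']
  show "dim_row (mat_adjoint (A \<otimes>\<^sub>m B)) = dim_row (mat_adjoint A \<otimes>\<^sub>m mat_adjoint B)"
    "dim_col (mat_adjoint (A \<otimes>\<^sub>m B)) = dim_col (mat_adjoint A \<otimes>\<^sub>m mat_adjoint B)"
    using AB' A'B' by auto
  fix p q assume "p < dim_row (mat_adjoint A \<otimes>\<^sub>m mat_adjoint B)"
    "q < dim_col (mat_adjoint A \<otimes>\<^sub>m mat_adjoint B)"
  then have pq: "p < b * d" "q < a * c" using A'B' by auto
  note p = div_mod_less[OF pq(1)] and q = div_mod_less[OF pq(2)]
  show "mat_adjoint (A \<otimes>\<^sub>m B) $$ (p, q) = (mat_adjoint A \<otimes>\<^sub>m mat_adjoint B) $$ (p, q)"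
    using kron_index[OF A B q p] kron_index[OF A' B' p q] p q pq
    by (simp add: mat_adjoint_index[OF AB] mat_adjoint_index[OF A] mat_adjoint_index[OF B])
qed

lemma unitary_mat_iff:
  assumes "U \<in> carrier_mat n n"
  shows "unitary_mat U \<longleftrightarrow> U * mat_adjoint U = 1\<^sub>m n \<and> mat_adjoint U * U = 1\<^sub>m n"
  using assms mat_adjoint_carrier[OF assms] by (auto simp: unitary_mat_def inverts_mat_def)

lemma unitary_mat_kron:
  assumes U: "U \<in> carrier_mat n n" and V: "V \<in> carrier_mat m m"
    and uU: "unitary_mat U" and uV: "unitary_mat V"
  shows "unitary_mat (U \<otimes>\<^sub>m V)"
  using uU uV mat_adjoint_carrier[OF U] mat_adjoint_carrier[OF V]
  by (simp add: unitary_mat_iff[OF U] unitary_mat_iff[OF V] unitary_mat_iff[OF kron_carrier[OF U V]]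
      mat_adjoint_kron[OF U V] kron_mult_kron[OF U V _ _] kron_mult_kron[OF _ _ U V] kron_one)

lemma flip_carrier [intro]: "flip m n \<in> carrier_mat (n * m) (m * n)"
  by (simp add: flip_def)

lemma flip_kron_vec:
  assumes v: "v \<in> carrier_vec m" and w: "w \<in> carrier_vec n"
  shows "flip m n *\<^sub>v (v \<otimes>\<^sub>v w) = w \<otimes>\<^sub>v v"
proof (rule eq_vec_timesI)
  show "flip m n *\<^sub>v (v \<otimes>\<^sub>v w) \<in> carrier_vec (n * m)"
    using flip_carrier kron_vec_carrier[OF v w] by (rule mult_mat_vec_carrier)
  show "w \<otimes>\<^sub>v v \<in> carrier_vec (n * m)" using w v by (rule kron_vec_carrier)
  fix i j assume ij: "i < n" "j < m"
  have "(flip m n *\<^sub>v (v \<otimes>\<^sub>v w)) $ (i * m + j)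
      = (\<Sum>k<m. \<Sum>l<n. if l = i then (if k = j then v $ k * w $ l else 0) else 0)"
    unfolding mult_mat_vec_index[OF flip_carrier kron_vec_carrier[OF v w] mult_add_less[OF ij]]
      sum_lessThan_times
  proof (intro sum.cong refl)
    fix k l assume "k \<in> {..<m}" "l \<in> {..<n}"
    then have kl: "k < m" "l < n" by auto
    \<comment> \<open>After splitting both indices, the div/mod condition defining
      \<open>flip\<close> becomes two Kronecker deltas, which collapse the double sum to the term k
      = j, l = i.\<close>
    have "flip m n $$ (i * m + j, k * n + l) = (if i = l \<and> j = k then 1 else 0)"
      using ij kl mult_add_less[OF ij] mult_add_less[OF kl] by (simp add: flip_def)
    then show "flip m n $$ (i * m + j, k * n + l) * (v \<otimes>\<^sub>v w) $ (k * n + l)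
        = (if l = i then (if k = j then v $ k * w $ l else 0) else 0)"
      by (auto simp only: kron_vec_index[OF v w kl] mult_1 mult_zero_left split: if_splits)
  qed
  also have "\<dots> = v $ j * w $ i"
    using ij by simp
  finally show "(flip m n *\<^sub>v (v \<otimes>\<^sub>v w)) $ (i * m + j) = (w \<otimes>\<^sub>v v) $ (i * m + j)"
    by (simp only: kron_vec_index[OF w v ij] mult.commute)
qed

text \<open>The definition yields the dimensions grouped as outer, middle pair, outer. They are
  restated in the grouping by pairs, which is the form in which the two coupling schemes have their
  codomains.\<close>

lemma middle_flip_carrier [intro]:
  "middle_flip a b c d \<in> carrier_mat ((a * c) * (b * d)) ((a * b) * (c * d))"
proof -
  have "middle_flip a b c d \<in> carrier_mat (a * (c * b * d)) (a * (b * c * d))"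
    unfolding middle_flip_def by (intro kron_carrier flip_carrier) auto
  then show ?thesis by (simp add: mult_ac)
qed

text \<open>By strict associativity v and w can be bracketed together, the flip acts on that pair,
  and the result is bracketed back into pairs.\<close>

lemma middle_flip_kron_vec:
  assumes u: "u \<in> carrier_vec a" and v: "v \<in> carrier_vec b"
    and w: "w \<in> carrier_vec c" and x: "x \<in> carrier_vec d"
  shows "middle_flip a b c d *\<^sub>v ((u \<otimes>\<^sub>v v) \<otimes>\<^sub>v (w \<otimes>\<^sub>v x)) = (u \<otimes>\<^sub>v w) \<otimes>\<^sub>v (v \<otimes>\<^sub>v x)"
proof -
  note F = flip_carrier[of b c]
  have "(u \<otimes>\<^sub>v v) \<otimes>\<^sub>v (w \<otimes>\<^sub>v x) = u \<otimes>\<^sub>v ((v \<otimes>\<^sub>v w) \<otimes>\<^sub>v x)"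
    by (simp add: kron_vec_assoc[OF u v kron_vec_carrier[OF w x]] kron_vec_assoc[OF v w x])
  then have "middle_flip a b c d *\<^sub>v ((u \<otimes>\<^sub>v v) \<otimes>\<^sub>v (w \<otimes>\<^sub>v x)) = u \<otimes>\<^sub>v ((w \<otimes>\<^sub>v v) \<otimes>\<^sub>v x)"
    using kron_mult_kron_vec[OF one_carrier_mat kron_carrier[OF F one_carrier_mat] u
        kron_vec_carrier[OF kron_vec_carrier[OF v w] x]]
      kron_mult_kron_vec[OF F one_carrier_mat kron_vec_carrier[OF v w] x] u x
    by (simp add: middle_flip_def flip_kron_vec[OF v w])
  then show ?thesis
    by (simp add: kron_vec_assoc[OF u w kron_vec_carrier[OF v x]] kron_vec_assoc[OF w v x])
qed

section \<open>Parseval frames\<close>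

text \<open>The entrywise form of the completeness relation: the projections onto the vectors
  \<open>e k\<close> add up to the identity. Encoding a basis in this way makes it immediate that
  tensor products inherit the property, without an argument about independence or spans. The family
  is indexed so that the sums run directly over weight labels.\<close>

definition parseval_frame :: "nat \<Rightarrow> 'k set \<Rightarrow> ('k \<Rightarrow> complex vec) \<Rightarrow> bool"
  where "parseval_frame n K e \<longleftrightarrow> finite K \<and> (\<forall>k\<in>K. e k \<in> carrier_vec n) \<and>
    (\<forall>i<n. \<forall>j<n. (\<Sum>k\<in>K. e k $ i * cnj (e k $ j)) = (if i = j then 1 else 0))"

text \<open>This is the insertion of a resolution of the identity. Once the sum over k is moved
  innermost, completeness leaves only the diagonal of the double sum over coordinates.\<close>

lemma parseval_frame_expansion:
  assumes e: "parseval_frame n K e" and v: "v \<in> carrier_vec n" and w: "w \<in> carrier_vec n"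
  shows "v \<bullet>c w = (\<Sum>k\<in>K. (v \<bullet>c e k) * (e k \<bullet>c w))"
proof -
  have "(\<Sum>k\<in>K. (v \<bullet>c e k) * (e k \<bullet>c w))
      = (\<Sum>k\<in>K. \<Sum>i<n. \<Sum>j<n. (v $ i * cnj (e k $ i)) * (e k $ j * cnj (w $ j)))"
  proof (rule sum.cong[OF refl])
    fix k assume "k \<in> K"
    then have "e k \<in> carrier_vec n" using e by (simp add: parseval_frame_def)
    then show "(v \<bullet>c e k) * (e k \<bullet>c w)
        = (\<Sum>i<n. \<Sum>j<n. (v $ i * cnj (e k $ i)) * (e k $ j * cnj (w $ j)))"
      by (simp only: cscalar_prod_sum[OF w] cscalar_prod_sum sum_product)
  qed
  also have "\<dots> = (\<Sum>i<n. \<Sum>k\<in>K. \<Sum>j<n. (v $ i * cnj (e k $ i)) * (e k $ j * cnj (w $ j)))"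
    by (rule sum.swap)
  also have "\<dots> = (\<Sum>i<n. \<Sum>j<n. \<Sum>k\<in>K. (v $ i * cnj (e k $ i)) * (e k $ j * cnj (w $ j)))"
    by (intro sum.cong refl sum.swap)
  also have "\<dots> = (\<Sum>i<n. \<Sum>j<n. v $ i * cnj (w $ j) * (\<Sum>k\<in>K. e k $ j * cnj (e k $ i)))"
    by (simp only: sum_distrib_left mult_ac)
  also have "\<dots> = (\<Sum>i<n. \<Sum>j<n. if i = j then v $ i * cnj (w $ j) else 0)"
    using e by (intro sum.cong refl) (auto simp: parseval_frame_def)
  also have "\<dots> = v \<bullet>c w"
    by (simp add: cscalar_prod_sum[OF w])
  finally show ?thesis by (rule sym)
qed

text \<open>At split indices the sum over \<open>K \<times> L\<close> is the product of the
  completeness sums of the two factors, and p = q holds exactly when both components agree.\<close>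

lemma parseval_frame_kron:
  assumes e: "parseval_frame n K e" and f: "parseval_frame m L f"
  shows "parseval_frame (n * m) (K \<times> L) (\<lambda>(k, l). e k \<otimes>\<^sub>v f l)"
  unfolding parseval_frame_def
proof (intro conjI ballI allI impI)
  show "finite (K \<times> L)" using e f by (simp add: parseval_frame_def)
  have ec: "e k \<in> carrier_vec n" if "k \<in> K" for k using e that by (simp add: parseval_frame_def)
  have fc: "f l \<in> carrier_vec m" if "l \<in> L" for l using f that by (simp add: parseval_frame_def)
  show "(case x of (k, l) \<Rightarrow> e k \<otimes>\<^sub>v f l) \<in> carrier_vec (n * m)" if "x \<in> K \<times> L" for x
    using that ec fc by auto
  fix p q assume p: "p < n * m" and q: "q < n * m"
  define i j i' j' where "i = p div m" and "j = p mod m" and "i' = q div m" and "j' = q mod m"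
  have pq: "i < n" "j < m" "i' < n" "j' < m" "p = i * m + j" "q = i' * m + j'"
    using div_mod_less[OF p] div_mod_less[OF q] by (auto simp: i_def j_def i'_def j'_def)
  have eq: "p = q \<longleftrightarrow> i = i' \<and> j = j'"
    by (metis pq(5,6) i_def j_def i'_def j'_def)
  have "(\<Sum>x\<in>K \<times> L. (case x of (k, l) \<Rightarrow> e k \<otimes>\<^sub>v f l) $ p * cnj ((case x of (k, l) \<Rightarrow> e k \<otimes>\<^sub>v f l) $ q))
      = (\<Sum>(k, l)\<in>K \<times> L. (e k $ i * cnj (e k $ i')) * (f l $ j * cnj (f l $ j')))"
    by (intro sum.cong refl)
      (auto simp: pq(5,6) kron_vec_index[OF ec fc pq(1,2)] kron_vec_index[OF ec fc pq(3,4)])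
  also have "\<dots> = (\<Sum>k\<in>K. e k $ i * cnj (e k $ i')) * (\<Sum>l\<in>L. f l $ j * cnj (f l $ j'))"
    by (simp only: sum_product sum.cartesian_product)
  also have "\<dots> = (if p = q then 1 else 0)"
    using e f pq(1-4) unfolding eq by (simp add: parseval_frame_def)
  finally show "(\<Sum>x\<in>K \<times> L. (case x of (k, l) \<Rightarrow> e k \<otimes>\<^sub>v f l) $ p
      * cnj ((case x of (k, l) \<Rightarrow> e k \<otimes>\<^sub>v f l) $ q)) = (if p = q then 1 else 0)" .
qed

text \<open>Orthonormality identifies the coefficients of a vector as its inner products with the
  basis; for standard unit vectors this expansion is the completeness relation.\<close>

lemma orthonormal_basis_parseval_frame:
  fixes e :: "'k \<Rightarrow> complex vec"
  assumes basis: "vectorspace.basis class_ring (module_vec TYPE(complex) n) (e ` K)"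
    and orth: "\<And>k l. k \<in> K \<Longrightarrow> l \<in> K \<Longrightarrow> e k \<bullet>c e l = (if k = l then 1 else 0)"
  shows "parseval_frame n K e"
proof -
  interpret vec_space "TYPE(complex)" n .
  have li: "lin_indpt (e ` K)" and gen: "span (e ` K) = carrier_vec n"
    and car: "e ` K \<subseteq> carrier_vec n"
    using basis by (auto simp: basis_def)
  \<comment> \<open>If two distinct labels had the same vector, its inner product with itself would
    be both 1 and 0. Injectivity transfers finiteness from the image to K and allows sums to be
    reindexed.\<close>
  have inj: "inj_on e K"
    using orth by (intro inj_onI) (metis one_neq_zero)
  have "finite (e ` K)"
    using fin_dim_li_fin[OF fin_dim li] car by simp
  then have fin: "finite K"
    using inj by (rule finite_imageD)
  have expand: "v $ i = (\<Sum>k\<in>K. (v \<bullet>c e k) * e k $ i)" if v: "v \<in> carrier_vec n" and i: "i < n" for v i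
  proof -
    from v have "v \<in> span (e ` K)" by (simp add: gen)
    then obtain a where a: "v = lincomb a (e ` K)"
      using finite_span[OF \<open>finite (e ` K)\<close>] car by auto
    have idx: "v $ j = (\<Sum>k\<in>K. a (e k) * e k $ j)" if "j < n" for j
      unfolding a lincomb_index[OF that car] by (rule sum.reindex_cong[OF inj]) auto
    have "v \<bullet>c e l = a (e l)" if l: "l \<in> K" for l
    proof -
      have el: "e l \<in> carrier_vec n" using l car by auto
      have "v \<bullet>c e l = (\<Sum>j<n. \<Sum>k\<in>K. a (e k) * (e k $ j * cnj (e l $ j)))"
        unfolding cscalar_prod_sum[OF el]
        by (intro sum.cong refl) (simp add: idx sum_distrib_right mult.assoc)
      also have "\<dots> = (\<Sum>k\<in>K. \<Sum>j<n. a (e k) * (e k $ j * cnj (e l $ j)))"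
        by (rule sum.swap)
      also have "\<dots> = (\<Sum>k\<in>K. a (e k) * (e k \<bullet>c e l))"
        by (simp only: cscalar_prod_sum[OF el] sum_distrib_left)
      also have "\<dots> = (\<Sum>k\<in>K. if k = l then a (e k) else 0)"
        using orth l by (intro sum.cong refl) simp
      also have "\<dots> = a (e l)" using fin l by simp
      finally show ?thesis .
    qed
    then show ?thesis using idx[OF i] by simp
  qed
  \<comment> \<open>This is \<open>expand\<close> for the unit vector with index j, whose inner
    product with \<open>e k\<close> is the conjugate of entry j.\<close>
  have "(\<Sum>k\<in>K. e k $ i * cnj (e k $ j)) = (if i = j then 1 else 0)" if i: "i < n" and j: "j < n" for i j
  proof -
    have "unit_vec n j \<bullet>c e k = cnj (e k $ j)" if "k \<in> K" for k
    proof -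
      have ek: "e k \<in> carrier_vec n" using that car by auto
      have "unit_vec n j \<bullet>c e k = (\<Sum>i<n. if i = j then cnj (e k $ i) else 0)"
        unfolding cscalar_prod_sum[OF ek] using j by (intro sum.cong refl) auto
      also have "\<dots> = cnj (e k $ j)" using j by simp
      finally show ?thesis .
    qed
    then have "(\<Sum>k\<in>K. e k $ i * cnj (e k $ j)) = (unit_vec n j :: complex vec) $ i"
      using expand[OF unit_vec_carrier i, of j] by (simp add: mult.commute)
    then show ?thesis using i j by auto
  qed
  then show ?thesis
    using fin car by (auto simp: parseval_frame_def)
qed

section \<open>Intertwiners\<close>

text \<open>Records only the shapes of the matrices. Intertwining is checked one group element at a
  time, so this suffices for composing and tensoring intertwiners, and tensor products and block
  sums can be handled without first showing that they are smooth homomorphisms.\<close>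

definition matrix_family :: "('g, 'm) monoid_scheme \<Rightarrow> 'g rep \<Rightarrow> bool"
  where "matrix_family G R \<longleftrightarrow> (\<forall>g\<in>carrier G. snd R g \<in> carrier_mat (fst R) (fst R))"

definition unitary_family :: "('g, 'm) monoid_scheme \<Rightarrow> 'g rep \<Rightarrow> bool"
  where "unitary_family G R \<longleftrightarrow> matrix_family G R \<and> (\<forall>g\<in>carrier G. unitary_mat (snd R g))"

definition intertwiner :: "('g, 'm) monoid_scheme \<Rightarrow> 'g rep \<Rightarrow> 'g rep \<Rightarrow> complex mat \<Rightarrow> bool"
  where "intertwiner G R R' X \<longleftrightarrow> X \<in> carrier_mat (fst R') (fst R) \<and>
    (\<forall>g\<in>carrier G. X * snd R g = snd R' g * X)"

lemma intertwiner_mult: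
  assumes R: "matrix_family G R" and R': "matrix_family G R'" and R'': "matrix_family G R''"
    and X: "intertwiner G R R' X" and Y: "intertwiner G R' R'' Y"
  shows "intertwiner G R R'' (Y * X)"
  unfolding intertwiner_def
proof (intro conjI ballI)
  have Xc: "X \<in> carrier_mat (fst R') (fst R)" and Yc: "Y \<in> carrier_mat (fst R'') (fst R')"
    using X Y by (auto simp: intertwiner_def)
  then show "Y * X \<in> carrier_mat (fst R'') (fst R)" by auto
  fix g assume g: "g \<in> carrier G"
  note c = R[unfolded matrix_family_def, rule_format, OF g]
    R'[unfolded matrix_family_def, rule_format, OF g] R''[unfolded matrix_family_def, rule_format, OF g]
  have "Y * X * snd R g = Y * (X * snd R g)" by (rule assoc_mult_mat[OF Yc Xc c(1)])
  also have "\<dots> = Y * (snd R' g * X)" using X g by (simp add: intertwiner_def)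
  also have "\<dots> = (Y * snd R' g) * X" by (rule assoc_mult_mat[OF Yc c(2) Xc, symmetric])
  also have "\<dots> = (snd R'' g * Y) * X" using Y g by (simp add: intertwiner_def)
  also have "\<dots> = snd R'' g * (Y * X)" by (rule assoc_mult_mat[OF c(3) Yc Xc])
  finally show "Y * X * snd R g = snd R'' g * (Y * X)" .
qed

text \<open>Taking adjoints of X D = D' X gives a relation between the adjoints of D and D'.
  Multiplying it by D on the left and by D' on the right cancels those adjoints by
  unitarity.\<close>

lemma intertwiner_adjoint:
  assumes R: "unitary_family G R" and R': "unitary_family G R'" and X: "intertwiner G R R' X"
  shows "intertwiner G R' R (mat_adjoint X)"
  unfolding intertwiner_def
proof (intro conjI ballI)
  have Xc: "X \<in> carrier_mat (fst R') (fst R)" using X by (auto simp: intertwiner_def)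
  then show X': "mat_adjoint X \<in> carrier_mat (fst R) (fst R')" by (rule mat_adjoint_carrier)
  fix g assume g: "g \<in> carrier G"
  define D D' where "D = snd R g" and "D' = snd R' g"
  have D: "D \<in> carrier_mat (fst R) (fst R)" and D': "D' \<in> carrier_mat (fst R') (fst R')"
    and "unitary_mat D" "unitary_mat D'"
    using R R' g by (auto simp: unitary_family_def matrix_family_def D_def D'_def)
  then have u: "D * mat_adjoint D = 1\<^sub>m (fst R)" and u': "mat_adjoint D' * D' = 1\<^sub>m (fst R')"
    by (simp_all add: unitary_mat_iff[OF D] unitary_mat_iff[OF D'])
  note a = mat_adjoint_carrier[OF D] and a' = mat_adjoint_carrier[OF D']
  have "mat_adjoint (X * D) = mat_adjoint (D' * X)"
    using X g by (simp add: intertwiner_def D_def D'_def)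
  then have eq: "mat_adjoint D * mat_adjoint X = mat_adjoint X * mat_adjoint D'"
    by (simp only: mat_adjoint_mult[OF Xc D] mat_adjoint_mult[OF D' Xc])
  have "D * mat_adjoint X = D * (mat_adjoint X * (mat_adjoint D' * D'))"
    using X' by (simp add: u')
  also have "mat_adjoint X * (mat_adjoint D' * D') = (mat_adjoint D * mat_adjoint X) * D'"
    unfolding eq by (rule assoc_mult_mat[OF X' a' D', symmetric])
  also have "\<dots> = mat_adjoint D * (mat_adjoint X * D')"
    by (rule assoc_mult_mat[OF a X' D'])
  also have "D * \<dots> = (D * mat_adjoint D) * (mat_adjoint X * D')"
    by (rule assoc_mult_mat[OF D a, symmetric]) (use X' D' in auto)
  also have "\<dots> = mat_adjoint X * D'"
    by (simp only: u left_mult_one_mat[OF mult_carrier_mat[OF X' D']])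
  finally show "mat_adjoint X * snd R' g = snd R g * mat_adjoint X"
    by (simp add: D_def D'_def)
qed

lemma intertwiner_kron:
  assumes R: "matrix_family G R1" "matrix_family G R2" "matrix_family G R1'" "matrix_family G R2'"
    and X: "intertwiner G R1 R1' X" and Y: "intertwiner G R2 R2' Y"
  shows "intertwiner G (tensor_rep R1 R2) (tensor_rep R1' R2') (X \<otimes>\<^sub>m Y)"
  unfolding intertwiner_def tensor_rep_def fst_conv snd_conv
proof (intro conjI ballI)
  have Xc: "X \<in> carrier_mat (fst R1') (fst R1)" and Yc: "Y \<in> carrier_mat (fst R2') (fst R2)"
    using X Y by (auto simp: intertwiner_def)
  then show "X \<otimes>\<^sub>m Y \<in> carrier_mat (fst R1' * fst R2') (fst R1 * fst R2)" by auto
  fix g assume g: "g \<in> carrier G"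
  note c = R[unfolded matrix_family_def, rule_format, OF g]
  show "(X \<otimes>\<^sub>m Y) * (snd R1 g \<otimes>\<^sub>m snd R2 g) = (snd R1' g \<otimes>\<^sub>m snd R2' g) * (X \<otimes>\<^sub>m Y)"
    using X Y g
    by (simp add: kron_mult_kron[OF Xc Yc c(1,2)] kron_mult_kron[OF c(3,4) Xc Yc] intertwiner_def)
qed

lemma matrix_family_tensor_rep:
  assumes "matrix_family G R" "matrix_family G R'"
  shows "matrix_family G (tensor_rep R R')"
  using assms by (auto simp: matrix_family_def tensor_rep_def)

lemma unitary_family_tensor_rep:
  assumes "unitary_family G R" "unitary_family G R'"
  shows "unitary_family G (tensor_rep R R')"
  using assms matrix_family_tensor_rep[of G R R']
  by (auto simp: unitary_family_def matrix_family_def tensor_rep_def intro: unitary_mat_kron)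

text \<open>Both sides send the product of u, v, w, x to the product of A u, C w, B v, D x.\<close>

lemma intertwiner_middle_flip:
  assumes R: "matrix_family G R1" "matrix_family G R2" "matrix_family G R3" "matrix_family G R4"
  shows "intertwiner G (tensor_rep (tensor_rep R1 R2) (tensor_rep R3 R4))
    (tensor_rep (tensor_rep R1 R3) (tensor_rep R2 R4))
    (middle_flip (fst R1) (fst R2) (fst R3) (fst R4))"
  unfolding intertwiner_def tensor_rep_def fst_conv snd_conv
proof (intro conjI ballI)
  let ?P = "middle_flip (fst R1) (fst R2) (fst R3) (fst R4)"
  have P: "?P \<in> carrier_mat ((fst R1 * fst R3) * (fst R2 * fst R4)) ((fst R1 * fst R2) * (fst R3 * fst R4))"
    by (rule middle_flip_carrier)
  then show "?P \<in> carrier_mat ((fst R1 * fst R3) * (fst R2 * fst R4)) ((fst R1 * fst R2) * (fst R3 * fst R4))" .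
  fix g assume g: "g \<in> carrier G"
  define A B C D where "A = snd R1 g" and "B = snd R2 g" and "C = snd R3 g" and "D = snd R4 g"
  note c = R[unfolded matrix_family_def, rule_format, OF g, folded A_def B_def C_def D_def]
  note k = kron_carrier[OF kron_carrier[OF c(1,2)] kron_carrier[OF c(3,4)]]
    kron_carrier[OF kron_carrier[OF c(1,3)] kron_carrier[OF c(2,4)]]
  have "?P * ((A \<otimes>\<^sub>m B) \<otimes>\<^sub>m (C \<otimes>\<^sub>m D)) = ((A \<otimes>\<^sub>m C) \<otimes>\<^sub>m (B \<otimes>\<^sub>m D)) * ?P"
  proof (rule eq_mat_kron_vec4I)
    show "?P * ((A \<otimes>\<^sub>m B) \<otimes>\<^sub>m (C \<otimes>\<^sub>m D)) \<in> carrier_mat ((fst R1 * fst R3) * (fst R2 * fst R4)) ((fst R1 * fst R2) * (fst R3 * fst R4))"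
      by (rule mult_carrier_mat[OF P k(1)])
    show "((A \<otimes>\<^sub>m C) \<otimes>\<^sub>m (B \<otimes>\<^sub>m D)) * ?P \<in> carrier_mat ((fst R1 * fst R3) * (fst R2 * fst R4)) ((fst R1 * fst R2) * (fst R3 * fst R4))"
      by (rule mult_carrier_mat[OF k(2) P])
    fix u v w x :: "complex vec"
    assume v: "u \<in> carrier_vec (fst R1)" "v \<in> carrier_vec (fst R2)"
      "w \<in> carrier_vec (fst R3)" "x \<in> carrier_vec (fst R4)"
    note Dv = mult_mat_vec_carrier[OF c(1) v(1)] mult_mat_vec_carrier[OF c(2) v(2)]
      mult_mat_vec_carrier[OF c(3) v(3)] mult_mat_vec_carrier[OF c(4) v(4)]
    note vv = kron_vec_carrier[OF kron_vec_carrier[OF v(1,2)] kron_vec_carrier[OF v(3,4)]]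
    have "(?P * ((A \<otimes>\<^sub>m B) \<otimes>\<^sub>m (C \<otimes>\<^sub>m D))) *\<^sub>v ((u \<otimes>\<^sub>v v) \<otimes>\<^sub>v (w \<otimes>\<^sub>v x))
        = ((A *\<^sub>v u) \<otimes>\<^sub>v (C *\<^sub>v w)) \<otimes>\<^sub>v ((B *\<^sub>v v) \<otimes>\<^sub>v (D *\<^sub>v x))"
      by (simp only: assoc_mult_mat_vec[OF P k(1) vv] middle_flip_kron_vec[OF Dv]
          kron_mult_kron_vec[OF kron_carrier[OF c(1,2)] kron_carrier[OF c(3,4)]
            kron_vec_carrier[OF v(1,2)] kron_vec_carrier[OF v(3,4)]]
          kron_mult_kron_vec[OF c(1,2) v(1,2)] kron_mult_kron_vec[OF c(3,4) v(3,4)])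
    also have "\<dots> = (((A \<otimes>\<^sub>m C) \<otimes>\<^sub>m (B \<otimes>\<^sub>m D)) * ?P) *\<^sub>v ((u \<otimes>\<^sub>v v) \<otimes>\<^sub>v (w \<otimes>\<^sub>v x))"
      by (simp only: assoc_mult_mat_vec[OF k(2) P vv] middle_flip_kron_vec[OF v]
          kron_mult_kron_vec[OF kron_carrier[OF c(1,3)] kron_carrier[OF c(2,4)]
            kron_vec_carrier[OF v(1,3)] kron_vec_carrier[OF v(2,4)]]
          kron_mult_kron_vec[OF c(1,3) v(1,3)] kron_mult_kron_vec[OF c(2,4) v(2,4)])
    finally show "(?P * ((A \<otimes>\<^sub>m B) \<otimes>\<^sub>m (C \<otimes>\<^sub>m D))) *\<^sub>v ((u \<otimes>\<^sub>v v) \<otimes>\<^sub>v (w \<otimes>\<^sub>v x))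
        = (((A \<otimes>\<^sub>m C) \<otimes>\<^sub>m (B \<otimes>\<^sub>m D)) * ?P) *\<^sub>v ((u \<otimes>\<^sub>v v) \<otimes>\<^sub>v (w \<otimes>\<^sub>v x))" .
  qed
  then show "?P * ((snd R1 g \<otimes>\<^sub>m snd R2 g) \<otimes>\<^sub>m (snd R3 g \<otimes>\<^sub>m snd R4 g))
      = ((snd R1 g \<otimes>\<^sub>m snd R3 g) \<otimes>\<^sub>m (snd R2 g \<otimes>\<^sub>m snd R4 g)) * ?P"
    by (simp only: A_def B_def C_def D_def)
qed

text \<open>A column through block x contains that block's column, shifted down by the total size of
  the preceding blocks, and zeros elsewhere. The bound on the column index is carried through the
  same induction because the entry formula for block matrices needs it. The offset refers to the
  first occurrence of x, where \<open>takeWhile\<close> stops.\<close>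

lemma diag_block_mat_column:
  assumes "x \<in> set xs" and "\<And>y. y \<in> set xs \<Longrightarrow> F y \<in> carrier_mat (d y) (d y)"
    and "r < sum_list (map d xs)" and "s < d x"
  shows "diag_block_mat (map F xs) $$ (r, sum_list (map d (takeWhile (\<lambda>y. y \<noteq> x) xs)) + s)
    = (let o' = sum_list (map d (takeWhile (\<lambda>y. y \<noteq> x) xs))
       in if o' \<le> r \<and> r < o' + d x then F x $$ (r - o', s) else 0)
    \<and> sum_list (map d (takeWhile (\<lambda>y. y \<noteq> x) xs)) + s < sum_list (map d xs)"
  using assms
proof (induction xs arbitrary: r)
  case (Cons y ys)
  have dim: "dim_row (diag_block_mat (map F ys)) = sum_list (map d ys)"
    "dim_col (diag_block_mat (map F ys)) = sum_list (map d ys)"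
    unfolding dim_diag_block_mat map_map o_def
    using Cons.prems(2) by (auto intro!: arg_cong[where f = sum_list] map_cong)
  have Fy: "dim_row (F y) = d y" "dim_col (F y) = d y" using Cons.prems(2)[of y] by auto
  show ?case
  proof (cases "y = x")
    case True
    then show ?thesis using Cons.prems(3,4) dim Fy by (auto simp: Let_def)
  next
    case False
    define o' where "o' = sum_list (map d (takeWhile (\<lambda>y. y \<noteq> x) ys))"
    have x: "x \<in> set ys" using Cons.prems(1) False by auto
    have IH: "diag_block_mat (map F ys) $$ (r', o' + s)
        = (if o' \<le> r' \<and> r' < o' + d x then F x $$ (r' - o', s) else 0) \<and> o' + s < sum_list (map d ys)"
      if "r' < sum_list (map d ys)" for r'
      using Cons.IH[OF x _ that Cons.prems(4)] Cons.prems(2) by (simp add: o'_def Let_def)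
    \<comment> \<open>If r lies in the first block, the induction hypothesis is wanted only for its
      bound on the column index, so it is applied to row 0. That row exists because
      \<open>s < d x\<close> makes the block of x nonempty.\<close>
    have ne: "0 < sum_list (map d ys)"
      using member_le_sum_list[of "d x" "map d ys"] x Cons.prems(4) by auto
    show ?thesis
    proof (cases "r < d y")
      case True
      then show ?thesis using False IH[OF ne] dim Fy Cons.prems(3)
        by (simp add: Let_def flip: o'_def)
    next
      case r: False
      then have "r - d y < sum_list (map d ys)" using Cons.prems(3) by auto
      from IH[OF this] show ?thesis using r False dim Fy Cons.prems(3)
        by (auto simp add: Let_def diff_diff_left simp flip: o'_def)
    qed
  qed
qed simp

text \<open>An eigenspace of M is invariant because M commutes with the group, and it is nonzero;
  irreducibility makes it the whole space.\<close>

lemma schur_scalar: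
  assumes irr: "irreducible_rep G R" and M: "intertwiner G R R M"
  shows "\<exists>z. \<forall>v\<in>carrier_vec (fst R). M *\<^sub>v v = z \<cdot>\<^sub>v v"
proof -
  define n where "n = fst R"
  have Mc: "M \<in> carrier_mat n n" using M by (auto simp: intertwiner_def n_def)
  have n: "n > 0" and D: "\<And>g. g \<in> carrier G \<Longrightarrow> snd R g \<in> carrier_mat n n"
    and inv: "\<And>W. VectorSpace.subspace class_ring W (module_vec TYPE(complex) n) \<Longrightarrow>
      (\<And>g w. g \<in> carrier G \<Longrightarrow> w \<in> W \<Longrightarrow> snd R g *\<^sub>v w \<in> W) \<Longrightarrow> W = {0\<^sub>v n} \<or> W = carrier_vec n"
    using irr by (auto simp: irreducible_rep_def is_rep_def n_def split: prod.splits)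
  \<comment> \<open>A complex matrix of positive size has an eigenvalue; irreducibility includes
    \<open>n > 0\<close>.\<close>
  obtain z where "eigenvalue M z"
    using spectrum_non_empty[OF Mc n] by (auto simp: spectrum_def)
  then obtain v where v: "v \<in> carrier_vec n" "v \<noteq> 0\<^sub>v n" "M *\<^sub>v v = z \<cdot>\<^sub>v v"
    using Mc by (auto simp: eigenvalue_def eigenvector_def)
  define W where "W = {w \<in> carrier_vec n. M *\<^sub>v w = z \<cdot>\<^sub>v w}"
  have "VectorSpace.subspace class_ring W (module_vec TYPE(complex) n)"
    unfolding VectorSpace.subspace_def
  proof (intro conjI vec_vs submodule.intro vec_module)
    show "W \<subseteq> carrier (module_vec TYPE(complex) n)" by (auto simp: W_def module_vec_simps)
    show "\<zero>\<^bsub>module_vec TYPE(complex) n\<^esub> \<in> W"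
      using Mc by (auto simp: W_def module_vec_simps)
    show "v \<oplus>\<^bsub>module_vec TYPE(complex) n\<^esub> w \<in> W" if "v \<in> W" "w \<in> W" for v w
      using that Mc by (auto simp: W_def module_vec_simps mult_add_distrib_mat_vec smult_add_distrib_vec)
    show "c \<odot>\<^bsub>module_vec TYPE(complex) n\<^esub> w \<in> W" if "c \<in> carrier class_ring" "w \<in> W" for c w
      using that Mc by (auto simp: W_def module_vec_simps mult_mat_vec smult_smult_assoc mult.commute)
  qed
  moreover have "snd R g *\<^sub>v w \<in> W" if g: "g \<in> carrier G" and w: "w \<in> W" for g w
  proof -
    have wc: "w \<in> carrier_vec n" and Mw: "M *\<^sub>v w = z \<cdot>\<^sub>v w" using w by (auto simp: W_def)
    have "M *\<^sub>v (snd R g *\<^sub>v w) = (M * snd R g) *\<^sub>v w"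
      by (rule assoc_mult_mat_vec[OF Mc D[OF g] wc, symmetric])
    also have "\<dots> = (snd R g * M) *\<^sub>v w" using M g by (simp add: intertwiner_def)
    also have "\<dots> = snd R g *\<^sub>v (z \<cdot>\<^sub>v w)"
      unfolding Mw[symmetric] by (rule assoc_mult_mat_vec[OF D[OF g] Mc wc])
    also have "\<dots> = z \<cdot>\<^sub>v (snd R g *\<^sub>v w)" by (rule mult_mat_vec[OF D[OF g] wc])
    finally show ?thesis using mult_mat_vec_carrier[OF D[OF g] wc] by (simp add: W_def)
  qed
  ultimately have "W = {0\<^sub>v n} \<or> W = carrier_vec n" by (rule inv)
  moreover have "v \<in> W" using v by (simp add: W_def)
  ultimately have "W = carrier_vec n" using v(2) by auto
  then show ?thesis by (auto simp: W_def n_def)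
qed

text \<open>Both products have at (r, s) the shifted entry of block x: on the left the injection
  selects one row of the block, on the right it selects column \<open>o' + s\<close> of the block
  sum.\<close>

lemma intertwiner_block_inj:
  fixes S :: "('g, 'e, 'l) rep_data"
  assumes fam: "\<And>y. y \<in> set xs \<Longrightarrow> matrix_family G (irr S (fst y))" and x: "x \<in> set xs"
  shows "intertwiner G (irr S (fst x)) (dsum_rep (map (\<lambda>(l, k). irr S l) xs)) (block_inj S xs x)"
  unfolding intertwiner_def
proof (intro conjI ballI)
  define d where "d = (\<lambda>y :: 'l \<times> nat. ldim S (fst y))"
  define o' where "o' = sum_list (map d (takeWhile (\<lambda>y. y \<noteq> x) xs))"
  let ?N = "sum_list (map d xs)" and ?J = "block_inj S xs x"
  have N: "fst (dsum_rep (map (\<lambda>(l, k). irr S l) xs)) = ?N"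
    by (simp add: dsum_rep_def d_def o_def case_prod_unfold)
  have J: "?J \<in> carrier_mat ?N (d x)"
    by (simp add: block_inj_def d_def Let_def)
  then show "?J \<in> carrier_mat (fst (dsum_rep (map (\<lambda>(l, k). irr S l) xs))) (ldim S (fst x))"
    by (simp add: N d_def)
  have J_index: "?J $$ (r, s) = (if r = o' + s then 1 else 0)" if "r < ?N" "s < d x" for r s
    using that by (simp add: block_inj_def o'_def d_def Let_def)
  fix g assume g: "g \<in> carrier G"
  define F where "F = (\<lambda>y :: 'l \<times> nat. snd (irr S (fst y)) g)"
  define D where "D = diag_block_mat (map F xs)"
  have F: "F y \<in> carrier_mat (d y) (d y)" if "y \<in> set xs" for y
    using fam[OF that] g by (simp add: matrix_family_def F_def d_def)
  have dims: "map dim_row (map F xs) = map d xs" "map dim_col (map F xs) = map d xs"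
    using F by auto
  have Dc: "D \<in> carrier_mat ?N ?N"
    unfolding D_def carrier_mat_def by (simp only: dim_diag_block_mat dims mem_Collect_eq)
  have D: "snd (dsum_rep (map (\<lambda>(l, k). irr S l) xs)) g = D"
    by (simp add: dsum_rep_def D_def F_def o_def case_prod_unfold)
  have col: "D $$ (r, o' + s) = (if o' \<le> r \<and> r < o' + d x then F x $$ (r - o', s) else 0)"
    and less: "o' + s < ?N" if "r < ?N" "s < d x" for r s
    using diag_block_mat_column[of x xs F d, OF x F that]
    by (auto simp: D_def o'_def Let_def)
  have "?J * F x = D * ?J"
  proof (rule eq_matI)
    show "dim_row (?J * F x) = dim_row (D * ?J)" "dim_col (?J * F x) = dim_col (D * ?J)"
      using J Dc F[OF x] by auto
    fix r s assume "r < dim_row (D * ?J)" "s < dim_col (D * ?J)"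
    then have rs: "r < ?N" "s < d x" using J Dc by auto
    have "(?J * F x) $$ (r, s) = (\<Sum>t<d x. if r = o' + t then F x $$ (t, s) else 0)"
      unfolding mult_mat_index[OF J F[OF x] rs]
      using rs by (intro sum.cong refl) (simp add: J_index)
    \<comment> \<open>Subtraction is truncated, so solving \<open>r = o' + t\<close> for t needs the
      guard \<open>o' \<le> r\<close>; otherwise t = 0 would be selected for rows above the
      block.\<close>
    also have "\<dots> = (\<Sum>t<d x. if t = r - o' then (if o' \<le> r then F x $$ (t, s) else 0) else 0)"
      by (intro sum.cong refl) auto
    also have "\<dots> = (if o' \<le> r \<and> r < o' + d x then F x $$ (r - o', s) else 0)"
      by auto
    also have "\<dots> = (\<Sum>t<?N. if t = o' + s then D $$ (r, t) else 0)"
      using less[OF rs] by (simp add: col[OF rs])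
    also have "\<dots> = (D * ?J) $$ (r, s)"
      unfolding mult_mat_index[OF Dc J rs]
      using rs by (intro sum.cong refl) (simp add: J_index)
    finally show "(?J * F x) $$ (r, s) = (D * ?J) $$ (r, s)" .
  qed
  then show "?J * snd (irr S (fst x)) g = snd (dsum_rep (map (\<lambda>(l, k). irr S l) xs)) g * ?J"
    unfolding D by (simp add: F_def)
qed

lemma matrix_family_dsum_rep:
  assumes "\<And>R. R \<in> set Rs \<Longrightarrow> matrix_family G R"
  shows "matrix_family G (dsum_rep Rs)"
  unfolding matrix_family_def dsum_rep_def fst_conv snd_conv
proof
  fix g assume g: "g \<in> carrier G"
  have "map dim_row (map (\<lambda>R. snd R g) Rs) = map fst Rs" "map dim_col (map (\<lambda>R. snd R g) Rs) = map fst Rs"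
    using assms g by (auto simp: matrix_family_def)
  then show "diag_block_mat (map (\<lambda>R. snd R g) Rs) \<in> carrier_mat (sum_list (map fst Rs)) (sum_list (map fst Rs))"
    unfolding carrier_mat_def by (simp only: dim_diag_block_mat mem_Collect_eq)
qed

section \<open>Frames and injections supplied by the fixed data\<close>

lemma rep_setting_unitary_family:
  assumes "rep_setting G S" "l \<in> labels S"
  shows "unitary_family G (irr S l)"
  using assms
  by (auto simp: rep_setting_def unitary_rep_def is_rep_def unitary_family_def matrix_family_def
      split: prod.splits)

lemma rep_setting_matrix_family:
  assumes "rep_setting G S" "l \<in> labels S"
  shows "matrix_family G (irr S l)"
  using rep_setting_unitary_family[OF assms] by (simp add: unitary_family_def)

lemma rep_setting_parseval_frame:
  assumes "rep_setting G S" "l \<in> labels S"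
  shows "parseval_frame (ldim S l) (wlabels G S l) (ket S l)"
  using assms
  by (intro orthonormal_basis_parseval_frame) (auto simp: rep_setting_def orthonormal_weight_basis_def)

text \<open>\<open>cg_iso\<close> maps the tensor product to the block sum, so the injection runs
  through its inverse. Since that inverse is the adjoint, multiplying the intertwining relation by
  it on both sides reverses the direction, using unitarity of the isomorphism and not of the block
  sum.\<close>

lemma intertwiner_inj_i:
  assumes S: "rep_setting G S" and l: "l1 \<in> labels S" "l2 \<in> labels S"
    and lk: "(l, k) \<in> cg_pairs G S l1 l2"
  shows "intertwiner G (irr S l) (tensor_rep (irr S l1) (irr S l2)) (inj_i S l1 l2 l k)"
proof -
  let ?T = "tensor_rep (irr S l1) (irr S l2)"
  let ?D = "dsum_rep (map (\<lambda>(l, k). irr S l) (summands S l1 l2))"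
  let ?U = "cg_iso S l1 l2"
  have "unitary_cg_iso G S l1 l2" using S l by (auto simp: rep_setting_def)
  then have set: "set (summands S l1 l2) = cg_pairs G S l1 l2"
    and U: "?U \<in> carrier_mat (fst ?D) (fst ?T)" and u: "unitary_mat ?U"
    and UT: "\<And>g. g \<in> carrier G \<Longrightarrow> ?U * snd ?T g = snd ?D g * ?U"
    by (auto simp: unitary_cg_iso_def Let_def)
  have mem: "fst y \<in> labels S" if "y \<in> set (summands S l1 l2)" for y
    using that by (auto simp: set cg_pairs_def)
  have fD: "matrix_family G ?D"
  proof (rule matrix_family_dsum_rep)
    fix R assume "R \<in> set (map (\<lambda>(l, k). irr S l) (summands S l1 l2))"
    then obtain y where "y \<in> set (summands S l1 l2)" "R = irr S (fst y)" by auto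
    then show "matrix_family G R" using rep_setting_matrix_family[OF S mem] by simp
  qed
  have fT: "matrix_family G ?T"
    by (intro matrix_family_tensor_rep rep_setting_matrix_family[OF S] l)
  have fl: "matrix_family G (irr S l)"
    using lk by (intro rep_setting_matrix_family[OF S]) (auto simp: cg_pairs_def)
  \<comment> \<open>\<open>unitary_mat\<close> includes squareness, which is how the two dimensions
    are known to agree.\<close>
  have sq: "fst ?D = fst ?T" using u U by (auto simp: unitary_mat_def)
  note U' = mat_adjoint_carrier[OF U]
  have uu: "?U * mat_adjoint ?U = 1\<^sub>m (fst ?D)" "mat_adjoint ?U * ?U = 1\<^sub>m (fst ?T)"
    using u U U' by (auto simp: unitary_mat_def inverts_mat_def)
  have "intertwiner G ?D ?T (mat_adjoint ?U)"
    unfolding intertwiner_def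
  proof (intro conjI ballI U')
    fix g assume g: "g \<in> carrier G"
    have D: "snd ?D g \<in> carrier_mat (fst ?D) (fst ?D)" and T: "snd ?T g \<in> carrier_mat (fst ?T) (fst ?T)"
      using fD fT g by (simp_all add: matrix_family_def)
    have "mat_adjoint ?U * snd ?D g = mat_adjoint ?U * (snd ?D g * (?U * mat_adjoint ?U))"
      by (simp only: uu right_mult_one_mat[OF D])
    also have "snd ?D g * (?U * mat_adjoint ?U) = ?U * snd ?T g * mat_adjoint ?U"
      unfolding UT[OF g] by (rule assoc_mult_mat[OF D U U', symmetric])
    also have "\<dots> = ?U * (snd ?T g * mat_adjoint ?U)"
      by (rule assoc_mult_mat[OF U T U'])
    also have "mat_adjoint ?U * \<dots> = (mat_adjoint ?U * ?U) * (snd ?T g * mat_adjoint ?U)"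
      by (rule assoc_mult_mat[OF U' U mult_carrier_mat[OF T U'], symmetric])
    also have "\<dots> = snd ?T g * mat_adjoint ?U"
      by (simp only: uu left_mult_one_mat[OF mult_carrier_mat[OF T U']])
    finally show "mat_adjoint ?U * snd ?D g = snd ?T g * mat_adjoint ?U" .
  qed
  moreover have "intertwiner G (irr S l) ?D (block_inj S (summands S l1 l2) (l, k))"
    using intertwiner_block_inj[of "summands S l1 l2" G S "(l, k)"] lk
    by (auto simp: set intro: rep_setting_matrix_family[OF S] dest: mem[unfolded set])
  ultimately show ?thesis
    unfolding inj_i_def by (intro intertwiner_mult[OF fl fD fT])
qed

text \<open>Covers both recoupling maps: \<open>A\<close> couples the labels by rows and
  \<open>B\<close> by columns, and the two differ only in the order of the four outer
  labels.\<close>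

lemma intertwiner_coupling:
  assumes S: "rep_setting G S" and l: "la \<in> labels S" "lb \<in> labels S" "lc \<in> labels S" "ld \<in> labels S"
    and p: "(l1, k1) \<in> cg_pairs G S la lb" "(l2, k2) \<in> cg_pairs G S lc ld" "(l, k) \<in> cg_pairs G S l1 l2"
  shows "intertwiner G (irr S l)
    (tensor_rep (tensor_rep (irr S la) (irr S lb)) (tensor_rep (irr S lc) (irr S ld)))
    ((inj_i S la lb l1 k1 \<otimes>\<^sub>m inj_i S lc ld l2 k2) * inj_i S l1 l2 l k)"
proof -
  have l': "l1 \<in> labels S" "l2 \<in> labels S" "l \<in> labels S" using p by (auto simp: cg_pairs_def)
  note f = rep_setting_matrix_family[OF S]
  show ?thesis
    by (rule intertwiner_mult[where R' = "tensor_rep (irr S l1) (irr S l2)"])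
      (intro matrix_family_tensor_rep intertwiner_kron intertwiner_inj_i[OF S] f l l' p)+
qed

text \<open>Evaluates the definite description. Moving the adjoint of \<open>A\<close> to the other
  side of the inner product then leaves two coupled vectors, each of which can be expanded
  separately.\<close>

lemma nine_lambda_eq:
  assumes S: "rep_setting G S"
    and l: "l11 \<in> labels S" "l12 \<in> labels S" "l21 \<in> labels S" "l22 \<in> labels S"
      "l31 \<in> labels S" "l32 \<in> labels S"
    and p: "(l1, k1) \<in> cg_pairs G S l11 l12" "(l2, k2) \<in> cg_pairs G S l21 l22"
      "(l3, k3) \<in> cg_pairs G S l31 l32" "(l31, ku1) \<in> cg_pairs G S l11 l21"
      "(l32, ku2) \<in> cg_pairs G S l12 l22" "(l3, k) \<in> cg_pairs G S l1 l2"
    and m3: "m3 \<in> wlabels G S l3"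
  defines "A \<equiv> (inj_i S l11 l12 l1 k1 \<otimes>\<^sub>m inj_i S l21 l22 l2 k2) * inj_i S l1 l2 l3 k"
    and "B \<equiv> (inj_i S l11 l21 l31 ku1 \<otimes>\<^sub>m inj_i S l12 l22 l32 ku2) * inj_i S l31 l32 l3 k3"
    and "P \<equiv> middle_flip (ldim S l11) (ldim S l21) (ldim S l12) (ldim S l22)"
  shows "nine_lambda G S l11 l12 l1 k1 l21 l22 l2 k2 l31 l32 l3 k3 ku1 ku2 k
    = (P *\<^sub>v (B *\<^sub>v ket S l3 m3)) \<bullet>c (A *\<^sub>v ket S l3 m3)"
proof -
  have l3: "l3 \<in> labels S" using p by (auto simp: cg_pairs_def)
  let ?n = "ldim S l3"
  define T where "T = tensor_rep (tensor_rep (irr S l11) (irr S l12)) (tensor_rep (irr S l21) (irr S l22))"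
  define T' where "T' = tensor_rep (tensor_rep (irr S l11) (irr S l21)) (tensor_rep (irr S l12) (irr S l22))"
  note f = rep_setting_matrix_family[OF S] and u = rep_setting_unitary_family[OF S]
  have fT: "matrix_family G T" "matrix_family G T'"
    unfolding T_def T'_def by (intro matrix_family_tensor_rep f l)+
  have uT: "unitary_family G T"
    unfolding T_def by (intro unitary_family_tensor_rep u l)
  have A: "intertwiner G (irr S l3) T A"
    unfolding T_def A_def using l(1-4) p(1,2,6) by (rule intertwiner_coupling[OF S])
  have B: "intertwiner G (irr S l3) T' B"
    unfolding T'_def B_def using l(1,3,2,4) p(4,5,3) by (rule intertwiner_coupling[OF S])
  have P: "intertwiner G T' T P"
    unfolding T_def T'_def P_def by (intro intertwiner_middle_flip f l)
  have A': "intertwiner G T (irr S l3) (mat_adjoint A)"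
    by (rule intertwiner_adjoint[OF u[OF l3] uT A])
  have M: "intertwiner G (irr S l3) (irr S l3) (mat_adjoint A * P * B)"
    by (rule intertwiner_mult[OF f[OF l3] fT(2) f[OF l3] B
          intertwiner_mult[OF fT(2,1) f[OF l3] P A']])
  obtain z where z: "\<And>v. v \<in> carrier_vec ?n \<Longrightarrow> (mat_adjoint A * P * B) *\<^sub>v v = z \<cdot>\<^sub>v v"
    using schur_scalar[OF _ M] S l3 by (auto simp: rep_setting_def)
  have ket: "ket S l3 \<mu> \<in> carrier_vec ?n" "ket S l3 \<mu> \<bullet>c ket S l3 \<mu> = 1" if "\<mu> \<in> wlabels G S l3" for \<mu>
    using rep_setting_parseval_frame[OF S l3] S l3 that
    by (auto simp: parseval_frame_def rep_setting_def orthonormal_weight_basis_def)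
  have val: "((mat_adjoint A * P * B) *\<^sub>v ket S l3 \<mu>) \<bullet>c ket S l3 \<mu> = z" if "\<mu> \<in> wlabels G S l3" for \<mu>
    using ket[OF that] by (simp add: z[OF ket(1)[OF that]])
  have "nine_lambda G S l11 l12 l1 k1 l21 l22 l2 k2 l31 l32 l3 k3 ku1 ku2 k = z"
    unfolding nine_lambda_def Let_def A_def[symmetric] B_def[symmetric] P_def[symmetric]
  proof (rule the_equality)
    show "\<forall>\<mu>\<in>wlabels G S l3. z = ((mat_adjoint A * P * B) *\<^sub>v ket S l3 \<mu>) \<bullet>c ket S l3 \<mu>"
      by (intro ballI) (rule val[symmetric])
    \<comment> \<open>Uniqueness rests on \<open>m3\<close>: without any weight label the defining
      condition would hold for every number.\<close>
    show "z' = z" if "\<forall>\<mu>\<in>wlabels G S l3. z' = ((mat_adjoint A * P * B) *\<^sub>v ket S l3 \<mu>) \<bullet>c ket S l3 \<mu>" for z'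
      using that m3 val[OF m3] by metis
  qed
  also have "\<dots> = ((mat_adjoint A * P * B) *\<^sub>v ket S l3 m3) \<bullet>c ket S l3 m3"
    by (rule val[OF m3, symmetric])
  also have "(mat_adjoint A * P * B) *\<^sub>v ket S l3 m3 = mat_adjoint A *\<^sub>v (P *\<^sub>v (B *\<^sub>v ket S l3 m3))"
  proof -
    have c: "mat_adjoint A \<in> carrier_mat ?n (fst T)" "P \<in> carrier_mat (fst T) (fst T')" "B \<in> carrier_mat (fst T') ?n"
      using A' P B by (auto simp: intertwiner_def)
    show ?thesis
      using assoc_mult_mat_vec[OF mult_carrier_mat[OF c(1,2)] c(3) ket(1)[OF m3]]
        assoc_mult_mat_vec[OF c(1,2) mult_mat_vec_carrier[OF c(3) ket(1)[OF m3]]] by simp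
  qed
  also have "\<dots> \<bullet>c ket S l3 m3 = (P *\<^sub>v (B *\<^sub>v ket S l3 m3)) \<bullet>c (A *\<^sub>v ket S l3 m3)"
  proof (rule cscalar_prod_adjoint')
    show "A \<in> carrier_mat (fst T) ?n" using A by (auto simp: intertwiner_def)
    show "P *\<^sub>v (B *\<^sub>v ket S l3 m3) \<in> carrier_vec (fst T)"
      using P B ket(1)[OF m3] by (auto simp: intertwiner_def intro!: mult_mat_vec_carrier)
  qed (rule ket(1)[OF m3])
  finally show ?thesis .
qed

section \<open>The unrestricted sum\<close>

lemma mat_adjoint_one: "mat_adjoint (1\<^sub>m n :: complex mat) = 1\<^sub>m n"
proof (rule eq_matI)
  note c = one_carrier_mat[where 'a = complex and n = n]
  show "dim_row (mat_adjoint (1\<^sub>m n :: complex mat)) = dim_row (1\<^sub>m n)"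
    "dim_col (mat_adjoint (1\<^sub>m n :: complex mat)) = dim_col (1\<^sub>m n)"
    using mat_adjoint_carrier[OF c] by auto
qed (auto simp: mat_adjoint_index[OF one_carrier_mat])

lemma mat_adjoint_flip: "mat_adjoint (flip m n) = flip n m"
proof (rule eq_matI)
  show "dim_row (mat_adjoint (flip m n)) = dim_row (flip n m)"
    "dim_col (mat_adjoint (flip m n)) = dim_col (flip n m)"
    using mat_adjoint_carrier[OF flip_carrier[of m n]] flip_carrier[of n m] by auto
  fix i j assume "i < dim_row (flip n m)" "j < dim_col (flip n m)"
  then have "i < m * n" "j < n * m" using flip_carrier[of n m] by auto
  then show "mat_adjoint (flip m n) $$ (i, j) = flip n m $$ (i, j)"
    by (simp add: mat_adjoint_index[OF flip_carrier]) (auto simp: flip_def)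
qed

text \<open>Through this the flip is moved from \<open>B\<close> onto a product basis vector, whose
  factors it rearranges into the order in which \<open>B\<close> couples them.\<close>

lemma mat_adjoint_middle_flip: "mat_adjoint (middle_flip a b c d) = middle_flip a c b d"
  unfolding middle_flip_def
  by (simp only: mat_adjoint_kron[OF one_carrier_mat kron_carrier[OF flip_carrier one_carrier_mat]]
      mat_adjoint_kron[OF flip_carrier one_carrier_mat] mat_adjoint_one mat_adjoint_flip)

text \<open>The operator \<open>X \<otimes>\<^sub>m Y\<close> is moved to the other side only to
  give the inner product the shape that \<open>parseval_frame_expansion\<close> expects; afterwards
  it is moved back and factors over the product vectors.\<close>

lemma coupling_coefficient:
  assumes e: "parseval_frame n1 K1 e1" and f: "parseval_frame n2 K2 e2"
    and X: "X \<in> carrier_mat a n1" and Y: "Y \<in> carrier_mat b n2" and Z: "Z \<in> carrier_mat (n1 * n2) n"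
    and v: "v \<in> carrier_vec n" and x: "x \<in> carrier_vec a" and y: "y \<in> carrier_vec b"
  shows "(((X \<otimes>\<^sub>m Y) * Z) *\<^sub>v v) \<bullet>c (x \<otimes>\<^sub>v y)
    = (\<Sum>k1\<in>K1. \<Sum>k2\<in>K2. ((Z *\<^sub>v v) \<bullet>c (e1 k1 \<otimes>\<^sub>v e2 k2)) * ((X *\<^sub>v e1 k1) \<bullet>c x) * ((Y *\<^sub>v e2 k2) \<bullet>c y))"
proof -
  note XY = kron_carrier[OF X Y] and xy = kron_vec_carrier[OF x y] and Zv = mult_mat_vec_carrier[OF Z v]
  have "(((X \<otimes>\<^sub>m Y) * Z) *\<^sub>v v) \<bullet>c (x \<otimes>\<^sub>v y) = (Z *\<^sub>v v) \<bullet>c (mat_adjoint (X \<otimes>\<^sub>m Y) *\<^sub>v (x \<otimes>\<^sub>v y))"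
    unfolding assoc_mult_mat_vec[OF XY Z v] by (rule cscalar_prod_adjoint[OF XY Zv xy])
  also have "\<dots> = (\<Sum>(k1, k2)\<in>K1 \<times> K2. ((Z *\<^sub>v v) \<bullet>c (e1 k1 \<otimes>\<^sub>v e2 k2))
      * ((e1 k1 \<otimes>\<^sub>v e2 k2) \<bullet>c (mat_adjoint (X \<otimes>\<^sub>m Y) *\<^sub>v (x \<otimes>\<^sub>v y))))"
    using parseval_frame_expansion[OF parseval_frame_kron[OF e f] Zv
        mult_mat_vec_carrier[OF mat_adjoint_carrier[OF XY] xy]]
    by (simp only: case_prod_unfold)
  also have "\<dots> = (\<Sum>(k1, k2)\<in>K1 \<times> K2. ((Z *\<^sub>v v) \<bullet>c (e1 k1 \<otimes>\<^sub>v e2 k2))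
      * ((X *\<^sub>v e1 k1) \<bullet>c x) * ((Y *\<^sub>v e2 k2) \<bullet>c y))"
  proof (intro sum.cong refl, clarify)
    fix k1 k2 assume "k1 \<in> K1" "k2 \<in> K2"
    then have c: "e1 k1 \<in> carrier_vec n1" "e2 k2 \<in> carrier_vec n2"
      using e f by (auto simp: parseval_frame_def)
    have "(e1 k1 \<otimes>\<^sub>v e2 k2) \<bullet>c (mat_adjoint (X \<otimes>\<^sub>m Y) *\<^sub>v (x \<otimes>\<^sub>v y))
        = ((X \<otimes>\<^sub>m Y) *\<^sub>v (e1 k1 \<otimes>\<^sub>v e2 k2)) \<bullet>c (x \<otimes>\<^sub>v y)"
      by (rule cscalar_prod_adjoint[OF XY kron_vec_carrier[OF c] xy, symmetric])
    also have "\<dots> = ((X *\<^sub>v e1 k1) \<bullet>c x) * ((Y *\<^sub>v e2 k2) \<bullet>c y)"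
      unfolding kron_mult_kron_vec[OF X Y c]
      by (rule cscalar_prod_kron_vec[OF mult_mat_vec_carrier[OF X c(1)] mult_mat_vec_carrier[OF Y c(2)] x y])
    finally show "((Z *\<^sub>v v) \<bullet>c (e1 k1 \<otimes>\<^sub>v e2 k2))
        * ((e1 k1 \<otimes>\<^sub>v e2 k2) \<bullet>c (mat_adjoint (X \<otimes>\<^sub>m Y) *\<^sub>v (x \<otimes>\<^sub>v y)))
      = ((Z *\<^sub>v v) \<bullet>c (e1 k1 \<otimes>\<^sub>v e2 k2)) * ((X *\<^sub>v e1 k1) \<bullet>c x) * ((Y *\<^sub>v e2 k2) \<bullet>c y)"
      by (simp only: mult.assoc)
  qed
  finally show ?thesis by (simp only: sum.cartesian_product)
qed

lemma inj_i_carrier: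
  assumes "rep_setting G S" "l1 \<in> labels S" "l2 \<in> labels S" "(l, k) \<in> cg_pairs G S l1 l2"
  shows "inj_i S l1 l2 l k \<in> carrier_mat (ldim S l1 * ldim S l2) (ldim S l)"
  using intertwiner_inj_i[OF assms] by (simp add: intertwiner_def tensor_rep_def)

lemma ket_carrier:
  assumes "rep_setting G S" "l \<in> labels S" "\<mu> \<in> wlabels G S l"
  shows "ket S l \<mu> \<in> carrier_vec (ldim S l)"
  using rep_setting_parseval_frame[OF assms(1,2)] assms(3) by (simp add: parseval_frame_def)

lemma coupling_coefficient_CG:
  assumes S: "rep_setting G S" and l: "la \<in> labels S" "lb \<in> labels S" "lc \<in> labels S" "ld \<in> labels S"
    and p: "(l1, k1) \<in> cg_pairs G S la lb" "(l2, k2) \<in> cg_pairs G S lc ld" "(l, k) \<in> cg_pairs G S l1 l2"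
    and m: "ma \<in> wlabels G S la" "mb \<in> wlabels G S lb" "mc \<in> wlabels G S lc" "md \<in> wlabels G S ld"
      "m \<in> wlabels G S l"
  shows "(((inj_i S la lb l1 k1 \<otimes>\<^sub>m inj_i S lc ld l2 k2) * inj_i S l1 l2 l k) *\<^sub>v ket S l m)
      \<bullet>c ((ket S la ma \<otimes>\<^sub>v ket S lb mb) \<otimes>\<^sub>v (ket S lc mc \<otimes>\<^sub>v ket S ld md))
    = (\<Sum>m1\<in>wlabels G S l1. \<Sum>m2\<in>wlabels G S l2.
        CG S l1 l2 l k m1 m2 m * CG S la lb l1 k1 ma mb m1 * CG S lc ld l2 k2 mc md m2)"
proof -
  have l': "l1 \<in> labels S" "l2 \<in> labels S" "l \<in> labels S" using p by (auto simp: cg_pairs_def)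
  show ?thesis
    unfolding CG_def
    by (rule coupling_coefficient[OF rep_setting_parseval_frame[OF S l'(1)]
          rep_setting_parseval_frame[OF S l'(2)] inj_i_carrier[OF S l(1,2) p(1)]
          inj_i_carrier[OF S l(3,4) p(2)] inj_i_carrier[OF S l'(1,2) p(3)]])
      (intro kron_vec_carrier ket_carrier[OF S] l l' m)+
qed

lemma sum_mult_cnj_sum:
  "(\<Sum>a\<in>A. \<Sum>b\<in>B. f a b) * cnj (\<Sum>c\<in>C. \<Sum>d\<in>D. g c d)
    = (\<Sum>a\<in>A. \<Sum>b\<in>B. \<Sum>c\<in>C. \<Sum>d\<in>D. f a b * cnj (g c d))"
  by (simp only: sum_distrib_right) (simp only: cnj_sum sum_distrib_left)

text \<open>The inner product is conjugate-linear in its second argument. The three conjugated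
  coefficients come from expanding the vector of \<open>A\<close>, which stands there; the other
  three come from the vector of \<open>B\<close>.\<close>

lemma nine_lambda_sum:
  assumes S: "rep_setting G S"
    and l: "l11 \<in> labels S" "l12 \<in> labels S" "l21 \<in> labels S" "l22 \<in> labels S"
      "l31 \<in> labels S" "l32 \<in> labels S"
    and p: "(l1, k1) \<in> cg_pairs G S l11 l12" "(l2, k2) \<in> cg_pairs G S l21 l22"
      "(l3, k3) \<in> cg_pairs G S l31 l32" "(l31, ku1) \<in> cg_pairs G S l11 l21"
      "(l32, ku2) \<in> cg_pairs G S l12 l22" "(l3, k) \<in> cg_pairs G S l1 l2"
    and m3: "m3 \<in> wlabels G S l3"
  shows "nine_lambda G S l11 l12 l1 k1 l21 l22 l2 k2 l31 l32 l3 k3 ku1 ku2 k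
    = (\<Sum>m11\<in>wlabels G S l11. \<Sum>m12\<in>wlabels G S l12. \<Sum>m21\<in>wlabels G S l21. \<Sum>m22\<in>wlabels G S l22.
       \<Sum>m31\<in>wlabels G S l31. \<Sum>m32\<in>wlabels G S l32. \<Sum>m1\<in>wlabels G S l1. \<Sum>m2\<in>wlabels G S l2.
         cnj (CG S l11 l12 l1 k1 m11 m12 m1) * cnj (CG S l21 l22 l2 k2 m21 m22 m2) *
         cnj (CG S l1 l2 l3 k m1 m2 m3) * CG S l11 l21 l31 ku1 m11 m21 m31 *
         CG S l12 l22 l32 ku2 m12 m22 m32 * CG S l31 l32 l3 k3 m31 m32 m3)"
proof -
  have l': "l1 \<in> labels S" "l2 \<in> labels S" "l3 \<in> labels S" using p by (auto simp: cg_pairs_def)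
  define n11 n12 n21 n22 where "n11 = ldim S l11" and "n12 = ldim S l12"
    and "n21 = ldim S l21" and "n22 = ldim S l22"
  define A where "A = (inj_i S l11 l12 l1 k1 \<otimes>\<^sub>m inj_i S l21 l22 l2 k2) * inj_i S l1 l2 l3 k"
  define B where "B = (inj_i S l11 l21 l31 ku1 \<otimes>\<^sub>m inj_i S l12 l22 l32 ku2) * inj_i S l31 l32 l3 k3"
  define P where "P = middle_flip n11 n21 n12 n22"
  define v where "v = ket S l3 m3"
  define e where "e = (\<lambda>((m11, m12), (m21, m22)).
    (ket S l11 m11 \<otimes>\<^sub>v ket S l12 m12) \<otimes>\<^sub>v (ket S l21 m21 \<otimes>\<^sub>v ket S l22 m22))"
  note inj = inj_i_carrier[OF S]
  have v: "v \<in> carrier_vec (ldim S l3)" unfolding v_def by (rule ket_carrier[OF S l'(3) m3])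
  have A: "A \<in> carrier_mat ((n11 * n12) * (n21 * n22)) (ldim S l3)"
    unfolding A_def n11_def n12_def n21_def n22_def
    by (rule mult_carrier_mat[OF kron_carrier inj]) (intro inj l l' p)+
  have B: "B \<in> carrier_mat ((n11 * n21) * (n12 * n22)) (ldim S l3)"
    unfolding B_def n11_def n12_def n21_def n22_def
    by (rule mult_carrier_mat[OF kron_carrier inj]) (intro inj l l' p)+
  have P: "P \<in> carrier_mat ((n11 * n12) * (n21 * n22)) ((n11 * n21) * (n12 * n22))"
    unfolding P_def by (rule middle_flip_carrier)
  note Av = mult_mat_vec_carrier[OF A v] and Bv = mult_mat_vec_carrier[OF B v]
  note PBv = mult_mat_vec_carrier[OF P Bv]
  let ?K = "(wlabels G S l11 \<times> wlabels G S l12) \<times> (wlabels G S l21 \<times> wlabels G S l22)"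
  have frame: "parseval_frame ((n11 * n12) * (n21 * n22)) ?K e"
  proof -
    \<comment> \<open>The family is rewritten as nested pairs so that
      \<open>parseval_frame_kron\<close> applies first to the two halves and then inside each
      half.\<close>
    have "e = (\<lambda>(x, y). (case x of (m11, m12) \<Rightarrow> ket S l11 m11 \<otimes>\<^sub>v ket S l12 m12)
        \<otimes>\<^sub>v (case y of (m21, m22) \<Rightarrow> ket S l21 m21 \<otimes>\<^sub>v ket S l22 m22))"
      by (auto simp: e_def fun_eq_iff)
    then show ?thesis
      unfolding n11_def n12_def n21_def n22_def
      by (simp only:) (intro parseval_frame_kron rep_setting_parseval_frame[OF S] l)
  qed
  have "nine_lambda G S l11 l12 l1 k1 l21 l22 l2 k2 l31 l32 l3 k3 ku1 ku2 k = (P *\<^sub>v (B *\<^sub>v v)) \<bullet>c (A *\<^sub>v v)"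
    unfolding A_def B_def P_def v_def n11_def n12_def n21_def n22_def by (rule nine_lambda_eq[OF S l p m3])
  also have "\<dots> = (\<Sum>\<mu>\<in>?K. ((P *\<^sub>v (B *\<^sub>v v)) \<bullet>c e \<mu>) * (e \<mu> \<bullet>c (A *\<^sub>v v)))"
    by (rule parseval_frame_expansion[OF frame PBv Av])
  also have "\<dots> = (\<Sum>((m11, m12), (m21, m22))\<in>?K.
      (\<Sum>m31\<in>wlabels G S l31. \<Sum>m32\<in>wlabels G S l32. CG S l31 l32 l3 k3 m31 m32 m3 *
        CG S l11 l21 l31 ku1 m11 m21 m31 * CG S l12 l22 l32 ku2 m12 m22 m32) *
      cnj (\<Sum>m1\<in>wlabels G S l1. \<Sum>m2\<in>wlabels G S l2. CG S l1 l2 l3 k m1 m2 m3 *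
        CG S l11 l12 l1 k1 m11 m12 m1 * CG S l21 l22 l2 k2 m21 m22 m2))"
  proof (intro sum.cong refl, clarify)
    \<comment> \<open>\<open>clarify\<close> also splits the labels, so within this block
      \<open>m11\<close> is only the weight and \<open>x11\<close> its multiplicity counter, and
      likewise for the others.\<close>
    fix m11 x11 m12 x12 m21 x21 m22 x22
    assume m: "(m11, x11) \<in> wlabels G S l11" "(m12, x12) \<in> wlabels G S l12"
      "(m21, x21) \<in> wlabels G S l21" "(m22, x22) \<in> wlabels G S l22"
    note kc = ket_carrier[OF S l(1) m(1), folded n11_def] ket_carrier[OF S l(2) m(2), folded n12_def]
      ket_carrier[OF S l(3) m(3), folded n21_def] ket_carrier[OF S l(4) m(4), folded n22_def]
    let ?\<mu> = "(((m11, x11), (m12, x12)), ((m21, x21), (m22, x22)))"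
    have ec: "e ?\<mu> \<in> carrier_vec ((n11 * n12) * (n21 * n22))"
      unfolding e_def prod.case by (intro kron_vec_carrier kc)
    have "(P *\<^sub>v (B *\<^sub>v v)) \<bullet>c e ?\<mu> = (B *\<^sub>v v) \<bullet>c (mat_adjoint P *\<^sub>v e ?\<mu>)"
      by (rule cscalar_prod_adjoint[OF P Bv ec])
    also have "mat_adjoint P *\<^sub>v e ?\<mu> = (ket S l11 (m11, x11) \<otimes>\<^sub>v ket S l21 (m21, x21))
        \<otimes>\<^sub>v (ket S l12 (m12, x12) \<otimes>\<^sub>v ket S l22 (m22, x22))"
      unfolding P_def mat_adjoint_middle_flip e_def prod.case by (rule middle_flip_kron_vec[OF kc])
    also have "(B *\<^sub>v v) \<bullet>c \<dots> = (\<Sum>m31\<in>wlabels G S l31. \<Sum>m32\<in>wlabels G S l32. CG S l31 l32 l3 k3 m31 m32 m3 *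
        CG S l11 l21 l31 ku1 (m11, x11) (m21, x21) m31 * CG S l12 l22 l32 ku2 (m12, x12) (m22, x22) m32)"
      unfolding B_def v_def using l(1,3,2,4) p(4,5,3) m(1,3,2,4) m3 by (rule coupling_coefficient_CG[OF S])
    moreover have "(A *\<^sub>v v) \<bullet>c e ?\<mu> = (\<Sum>m1\<in>wlabels G S l1. \<Sum>m2\<in>wlabels G S l2. CG S l1 l2 l3 k m1 m2 m3 *
        CG S l11 l12 l1 k1 (m11, x11) (m12, x12) m1 * CG S l21 l22 l2 k2 (m21, x21) (m22, x22) m2)"
      unfolding A_def v_def e_def prod.case using l(1-4) p(1,2,6) m m3 by (rule coupling_coefficient_CG[OF S])
    then have "e ?\<mu> \<bullet>c (A *\<^sub>v v) = cnj (\<Sum>m1\<in>wlabels G S l1. \<Sum>m2\<in>wlabels G S l2. CG S l1 l2 l3 k m1 m2 m3 *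
        CG S l11 l12 l1 k1 (m11, x11) (m12, x12) m1 * CG S l21 l22 l2 k2 (m21, x21) (m22, x22) m2)"
      using cnj_cscalar_prod[OF Av ec] by simp
    ultimately show "((P *\<^sub>v (B *\<^sub>v v)) \<bullet>c e ?\<mu>) * (e ?\<mu> \<bullet>c (A *\<^sub>v v)) =
      (\<Sum>m31\<in>wlabels G S l31. \<Sum>m32\<in>wlabels G S l32. CG S l31 l32 l3 k3 m31 m32 m3 *
        CG S l11 l21 l31 ku1 (m11, x11) (m21, x21) m31 * CG S l12 l22 l32 ku2 (m12, x12) (m22, x22) m32) *
      cnj (\<Sum>m1\<in>wlabels G S l1. \<Sum>m2\<in>wlabels G S l2. CG S l1 l2 l3 k m1 m2 m3 *
        CG S l11 l12 l1 k1 (m11, x11) (m12, x12) m1 * CG S l21 l22 l2 k2 (m21, x21) (m22, x22) m2)"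
      by (simp only:)
  qed
  finally show ?thesis
    by (simp only: sum.cartesian_product' prod.case sum_mult_cnj_sum complex_cnj_mult mult_ac)
qed

section \<open>Weight selection rule\<close>

lemma lie_group_chart:
  assumes G: "lie_group G" and c: "c \<in> lg_atlas G"
  shows "fst c \<subseteq> carrier G" "open (chart_image c)" "inj_on (snd c) (fst c)"
proof -
  have T: "topspace (lg_topology G) = carrier G"
    and op: "openin (lg_topology G) (fst c)" and im: "open (chart_image c)"
    and hom: "homeomorphic_map (subtopology (lg_topology G) (fst c)) (top_of_set (chart_image c)) (snd c)"
    using G c by (auto simp: lie_group_def smooth_manifold_def)
  show sub: "fst c \<subseteq> carrier G" using openin_subset[OF op] T by simp
  show "open (chart_image c)" by (rule im)
  show "inj_on (snd c) (fst c)"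
    using homeomorphic_imp_injective_map[OF hom] sub T
    by (simp add: Int_absorb1)
qed

text \<open>The value of \<open>frechet_derivative\<close> is meaningful only at points of
  differentiability. Smoothness of the matrix coefficients, used in its first order, makes the
  entries of \<open>rep_diff\<close> actual derivatives.\<close>

lemma has_derivative_matrix_coefficient:
  assumes R: "is_rep G R" and c: "c \<in> lg_atlas G" and one: "\<one>\<^bsub>G\<^esub> \<in> fst c"
    and ij: "i < fst R" "j < fst R"
  shows "((\<lambda>x. snd R (chart_inv c x) $$ (i, j)) has_derivative (\<lambda>X. rep_diff G c R X $$ (i, j)))
    (at (snd c \<one>\<^bsub>G\<^esub>))"
proof -
  let ?f = "\<lambda>x. snd R (chart_inv c x) $$ (i, j)"
  have "smooth_fun G (\<lambda>g. snd R g $$ (i, j))"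
    using R ij by (auto simp: is_rep_def split: prod.splits)
  then have "Ck_on (Suc 0) ?f (chart_image c)"
    unfolding smooth_fun_def smooth_on_def using c by blast
  then have "?f differentiable (at (snd c \<one>\<^bsub>G\<^esub>))"
    using one by auto
  then have "(?f has_derivative frechet_derivative ?f (at (snd c \<one>\<^bsub>G\<^esub>))) (at (snd c \<one>\<^bsub>G\<^esub>))"
    by (simp add: frechet_derivative_works)
  also have "frechet_derivative ?f (at (snd c \<one>\<^bsub>G\<^esub>)) = (\<lambda>X. rep_diff G c R X $$ (i, j))"
    using ij by (simp add: rep_diff_def)
  finally show ?thesis .
qed

lemma rep_diff_carrier [intro]: "rep_diff G c R X \<in> carrier_mat (fst R) (fst R)"
  by (simp add: rep_diff_def)

text \<open>The operator multiplying Z is the action of the Lie algebra on a tensor product. It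
  arises from the product rule at the unit, where the undifferentiated factor is the identity
  matrix. The argument goes entry by entry because \<open>rep_diff\<close> is defined that
  way.\<close>

lemma intertwiner_rep_diff:
  assumes G: "lie_group G" and c: "c \<in> lg_atlas G" and one: "\<one>\<^bsub>G\<^esub> \<in> fst c"
    and R: "is_rep G R" "is_rep G R1" "is_rep G R2"
    and Z: "intertwiner G (tensor_rep R1 R2) R Z"
  shows "Z * (rep_diff G c R1 X \<otimes>\<^sub>m 1\<^sub>m (fst R2) + 1\<^sub>m (fst R1) \<otimes>\<^sub>m rep_diff G c R2 X)
    = rep_diff G c R X * Z"
proof (rule eq_matI)
  let ?n = "fst R" and ?n1 = "fst R1" and ?n2 = "fst R2" and ?x0 = "snd c \<one>\<^bsub>G\<^esub>"
  let ?d = "rep_diff G c R" and ?d1 = "rep_diff G c R1" and ?d2 = "rep_diff G c R2"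
  let ?K = "?d1 X \<otimes>\<^sub>m 1\<^sub>m ?n2 + 1\<^sub>m ?n1 \<otimes>\<^sub>m ?d2 X"
  have Zc: "Z \<in> carrier_mat ?n (?n1 * ?n2)"
    using Z by (simp add: intertwiner_def tensor_rep_def)
  have dc: "?d X \<in> carrier_mat ?n ?n" "?d1 X \<in> carrier_mat ?n1 ?n1" "?d2 X \<in> carrier_mat ?n2 ?n2"
    by (rule rep_diff_carrier)+
  have K1: "?d1 X \<otimes>\<^sub>m 1\<^sub>m ?n2 \<in> carrier_mat (?n1 * ?n2) (?n1 * ?n2)"
    and K2: "1\<^sub>m ?n1 \<otimes>\<^sub>m ?d2 X \<in> carrier_mat (?n1 * ?n2) (?n1 * ?n2)"
    using dc by auto
  then have K: "?K \<in> carrier_mat (?n1 * ?n2) (?n1 * ?n2)" by auto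
  show "dim_row (Z * ?K) = dim_row (?d X * Z)" "dim_col (Z * ?K) = dim_col (?d X * Z)"
    using Zc K dc by auto
  fix r q assume "r < dim_row (?d X * Z)" "q < dim_col (?d X * Z)"
  then have r: "r < ?n" and q: "q < ?n1 * ?n2" using Zc dc by auto
  define q1 q2 where "q1 = q div ?n2" and "q2 = q mod ?n2"
  have q12: "q1 < ?n1" "q2 < ?n2" and q': "q = q1 * ?n2 + q2"
    using div_mod_less[OF q] by (auto simp: q1_def q2_def)
  have one_D: "snd R1 \<one>\<^bsub>G\<^esub> = 1\<^sub>m ?n1" "snd R2 \<one>\<^bsub>G\<^esub> = 1\<^sub>m ?n2"
    and D: "\<And>g. g \<in> carrier G \<Longrightarrow> snd R g \<in> carrier_mat ?n ?n"
      "\<And>g. g \<in> carrier G \<Longrightarrow> snd R1 g \<in> carrier_mat ?n1 ?n1"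
      "\<And>g. g \<in> carrier G \<Longrightarrow> snd R2 g \<in> carrier_mat ?n2 ?n2"
    using R by (auto simp: is_rep_def split: prod.splits)
  note chart = lie_group_chart[OF G c]
  have x0: "?x0 \<in> chart_image c" using one by auto
  \<comment> \<open>Injectivity of the chart ensures that \<open>inv_into\<close> returns the unit
    itself and not some other preimage.\<close>
  have inv_x0: "chart_inv c ?x0 = \<one>\<^bsub>G\<^esub>" using chart(3) one by simp
  \<comment> \<open>\<open>L\<close> and \<open>M\<close> are the entries (r, q) of the two sides of
    the intertwining relation, as functions of the chart coordinate.\<close>
  define L where "L = (\<lambda>x. \<Sum>p1<?n1. \<Sum>p2<?n2. Z $$ (r, p1 * ?n2 + p2) *
    (snd R1 (chart_inv c x) $$ (p1, q1) * snd R2 (chart_inv c x) $$ (p2, q2)))"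
  define M where "M = (\<lambda>x. \<Sum>s<?n. snd R (chart_inv c x) $$ (r, s) * Z $$ (s, q))"
  have LM: "L x = M x" if x: "x \<in> chart_image c" for x
  proof -
    define g where "g = chart_inv c x"
    have "g \<in> fst c" using x unfolding g_def by (rule inv_into_into)
    then have g: "g \<in> carrier G" using chart(1) by auto
    have "(Z * (snd R1 g \<otimes>\<^sub>m snd R2 g)) $$ (r, q) = (snd R g * Z) $$ (r, q)"
      using Z g by (simp add: intertwiner_def tensor_rep_def)
    moreover have "(Z * (snd R1 g \<otimes>\<^sub>m snd R2 g)) $$ (r, q) = L x"
      unfolding mult_mat_index[OF Zc kron_carrier[OF D(2,3)[OF g]] r q] sum_lessThan_times L_def g_def[symmetric]
      by (intro sum.cong refl) (simp only: q' kron_index[OF D(2,3)[OF g] _ _ q12] lessThan_iff)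
    moreover have "(snd R g * Z) $$ (r, q) = M x"
      unfolding M_def g_def[symmetric] by (rule mult_mat_index[OF D(1)[OF g] Zc r q])
    ultimately show ?thesis by simp
  qed
  have "(L has_derivative (\<lambda>X. \<Sum>p1<?n1. \<Sum>p2<?n2. Z $$ (r, p1 * ?n2 + p2) *
      (snd R1 (chart_inv c ?x0) $$ (p1, q1) * ?d2 X $$ (p2, q2)
       + ?d1 X $$ (p1, q1) * snd R2 (chart_inv c ?x0) $$ (p2, q2)))) (at ?x0)"
    unfolding L_def
    using R c one q12
    by (intro has_derivative_sum has_derivative_mult_right has_derivative_mult
        has_derivative_matrix_coefficient) auto
  \<comment> \<open>\<open>L\<close> and \<open>M\<close> agree only on the chart image. This is an
    open set around the base point, so the derivative of \<open>L\<close> is also one of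
    \<open>M\<close>, and uniqueness of derivatives equates the two formulas.\<close>
  then have dL: "(M has_derivative (\<lambda>X. \<Sum>p1<?n1. \<Sum>p2<?n2. Z $$ (r, p1 * ?n2 + p2) *
      (snd R1 (chart_inv c ?x0) $$ (p1, q1) * ?d2 X $$ (p2, q2)
       + ?d1 X $$ (p1, q1) * snd R2 (chart_inv c ?x0) $$ (p2, q2)))) (at ?x0)"
    by (rule has_derivative_transform_within_open[OF _ chart(2) x0 LM])
  have dM: "(M has_derivative (\<lambda>X. \<Sum>s<?n. ?d X $$ (r, s) * Z $$ (s, q))) (at ?x0)"
    unfolding M_def
    using R c one r
    by (intro has_derivative_sum has_derivative_mult_left has_derivative_matrix_coefficient) auto
  have "(Z * ?K) $$ (r, q) = (\<Sum>p1<?n1. \<Sum>p2<?n2. Z $$ (r, p1 * ?n2 + p2) *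
      (snd R1 (chart_inv c ?x0) $$ (p1, q1) * ?d2 X $$ (p2, q2)
       + ?d1 X $$ (p1, q1) * snd R2 (chart_inv c ?x0) $$ (p2, q2)))"
    unfolding mult_mat_index[OF Zc K r q] sum_lessThan_times inv_x0 one_D
  proof (intro sum.cong refl)
    fix p1 p2 assume "p1 \<in> {..<?n1}" "p2 \<in> {..<?n2}"
    then have p: "p1 < ?n1" "p2 < ?n2" by auto
    have "?K $$ (p1 * ?n2 + p2, q) = (?d1 X \<otimes>\<^sub>m 1\<^sub>m ?n2) $$ (p1 * ?n2 + p2, q1 * ?n2 + q2)
        + (1\<^sub>m ?n1 \<otimes>\<^sub>m ?d2 X) $$ (p1 * ?n2 + p2, q1 * ?n2 + q2)"
      using K1 K2 mult_add_less[OF p] q by (simp add: q')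
    then show "Z $$ (r, p1 * ?n2 + p2) * ?K $$ (p1 * ?n2 + p2, q) = Z $$ (r, p1 * ?n2 + p2) *
      (1\<^sub>m ?n1 $$ (p1, q1) * ?d2 X $$ (p2, q2) + ?d1 X $$ (p1, q1) * 1\<^sub>m ?n2 $$ (p2, q2))"
      unfolding kron_index[OF dc(2) one_carrier_mat p q12] kron_index[OF one_carrier_mat dc(3) p q12]
      by (simp only: add.commute)
  qed
  also have "\<dots> = (\<Sum>s<?n. ?d X $$ (r, s) * Z $$ (s, q))"
    using has_derivative_unique[OF dL dM] by (rule fun_cong)
  also have "\<dots> = (?d X * Z) $$ (r, q)"
    unfolding mult_mat_index[OF dc(1) Zc r q] ..
  finally show "(Z * ?K) $$ (r, q) = (?d X * Z) $$ (r, q)" .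
qed

lemma smult_kron_vec: "(a \<cdot>\<^sub>v v) \<otimes>\<^sub>v w = a \<cdot>\<^sub>v (v \<otimes>\<^sub>v w)"
  if "v \<in> carrier_vec n" "w \<in> carrier_vec m"
proof (rule eq_vec_timesI)
  show "(a \<cdot>\<^sub>v v) \<otimes>\<^sub>v w \<in> carrier_vec (n * m)" "a \<cdot>\<^sub>v (v \<otimes>\<^sub>v w) \<in> carrier_vec (n * m)"
    using that by auto
  fix i j assume ij: "i < n" "j < m"
  have "(a \<cdot>\<^sub>v (v \<otimes>\<^sub>v w)) $ (i * m + j) = a * (v \<otimes>\<^sub>v w) $ (i * m + j)"
    using kron_vec_carrier[OF that] mult_add_less[OF ij] by simp
  then show "((a \<cdot>\<^sub>v v) \<otimes>\<^sub>v w) $ (i * m + j) = (a \<cdot>\<^sub>v (v \<otimes>\<^sub>v w)) $ (i * m + j)"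
    using that ij
    unfolding kron_vec_index[OF that ij] kron_vec_index[OF smult_carrier_vec[THEN iffD2, OF that(1)] that(2) ij] by simp
qed

lemma kron_vec_smult: "v \<otimes>\<^sub>v (a \<cdot>\<^sub>v w) = a \<cdot>\<^sub>v (v \<otimes>\<^sub>v w)"
  if "v \<in> carrier_vec n" "w \<in> carrier_vec m"
proof (rule eq_vec_timesI)
  show "v \<otimes>\<^sub>v (a \<cdot>\<^sub>v w) \<in> carrier_vec (n * m)" "a \<cdot>\<^sub>v (v \<otimes>\<^sub>v w) \<in> carrier_vec (n * m)"
    using that by auto
  fix i j assume ij: "i < n" "j < m"
  have "(a \<cdot>\<^sub>v (v \<otimes>\<^sub>v w)) $ (i * m + j) = a * (v \<otimes>\<^sub>v w) $ (i * m + j)"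
    using kron_vec_carrier[OF that] mult_add_less[OF ij] by simp
  then show "(v \<otimes>\<^sub>v (a \<cdot>\<^sub>v w)) $ (i * m + j) = (a \<cdot>\<^sub>v (v \<otimes>\<^sub>v w)) $ (i * m + j)"
    using that ij
    unfolding kron_vec_index[OF that ij] kron_vec_index[OF that(1) smult_carrier_vec[THEN iffD2, OF that(2)] ij] by simp
qed

text \<open>The product vector is an eigenvector of the tensor action with eigenvalue
  \<open>\<alpha> X + \<beta> X\<close>, and Z carries it over. The image may be zero, so the sum of
  the weights need not be a weight of R; the conclusion is membership in a possibly trivial weight
  space.\<close>

lemma weight_space_kron_vec:
  assumes G: "lie_group G" and c: "c \<in> lg_atlas G" and one: "\<one>\<^bsub>G\<^esub> \<in> fst c"
    and R: "is_rep G R" "is_rep G R1" "is_rep G R2"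
    and Z: "intertwiner G (tensor_rep R1 R2) R Z"
    and u: "u \<in> weight_space G c \<tt> R1 \<alpha>" and w: "w \<in> weight_space G c \<tt> R2 \<beta>"
  shows "Z *\<^sub>v (u \<otimes>\<^sub>v w) \<in> weight_space G c \<tt> R (\<alpha> +\<^sub>w \<beta>)"
proof -
  let ?n = "fst R" and ?n1 = "fst R1" and ?n2 = "fst R2"
  have Zc: "Z \<in> carrier_mat ?n (?n1 * ?n2)"
    using Z by (simp add: intertwiner_def tensor_rep_def)
  have uc: "u \<in> carrier_vec ?n1" and wc: "w \<in> carrier_vec ?n2"
    using u w by (auto simp: weight_space_def)
  note uw = kron_vec_carrier[OF uc wc]
  have "rep_diff G c R X *\<^sub>v (Z *\<^sub>v (u \<otimes>\<^sub>v w)) = (\<alpha> +\<^sub>w \<beta>) X \<cdot>\<^sub>v (Z *\<^sub>v (u \<otimes>\<^sub>v w))" if X: "X \<in> \<tt>" for X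
  proof -
    note d = rep_diff_carrier[of G c R X] and d1 = rep_diff_carrier[of G c R1 X]
      and d2 = rep_diff_carrier[of G c R2 X]
    note K1 = kron_carrier[OF d1 one_carrier_mat[of ?n2]] and K2 = kron_carrier[OF one_carrier_mat[of ?n1] d2]
    have "rep_diff G c R X *\<^sub>v (Z *\<^sub>v (u \<otimes>\<^sub>v w)) = (rep_diff G c R X * Z) *\<^sub>v (u \<otimes>\<^sub>v w)"
      by (rule assoc_mult_mat_vec[OF d Zc uw, symmetric])
    also have "\<dots> = Z *\<^sub>v ((rep_diff G c R1 X \<otimes>\<^sub>m 1\<^sub>m ?n2 + 1\<^sub>m ?n1 \<otimes>\<^sub>m rep_diff G c R2 X) *\<^sub>v (u \<otimes>\<^sub>v w))"
      unfolding intertwiner_rep_diff[OF G c one R Z, of X, symmetric]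
      by (rule assoc_mult_mat_vec[OF Zc add_carrier_mat[OF K2] uw])
    also have "(rep_diff G c R1 X \<otimes>\<^sub>m 1\<^sub>m ?n2 + 1\<^sub>m ?n1 \<otimes>\<^sub>m rep_diff G c R2 X) *\<^sub>v (u \<otimes>\<^sub>v w)
        = (rep_diff G c R1 X \<otimes>\<^sub>m 1\<^sub>m ?n2) *\<^sub>v (u \<otimes>\<^sub>v w) + (1\<^sub>m ?n1 \<otimes>\<^sub>m rep_diff G c R2 X) *\<^sub>v (u \<otimes>\<^sub>v w)"
      by (rule add_mult_distrib_mat_vec[OF K1 K2 uw])
    also have "(rep_diff G c R1 X \<otimes>\<^sub>m 1\<^sub>m ?n2) *\<^sub>v (u \<otimes>\<^sub>v w) = \<alpha> X \<cdot>\<^sub>v (u \<otimes>\<^sub>v w)"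
      using u X by (simp add: kron_mult_kron_vec[OF d1 one_carrier_mat uc wc] one_mult_mat_vec[OF wc]
          weight_space_def smult_kron_vec[OF uc wc])
    also have "(1\<^sub>m ?n1 \<otimes>\<^sub>m rep_diff G c R2 X) *\<^sub>v (u \<otimes>\<^sub>v w) = \<beta> X \<cdot>\<^sub>v (u \<otimes>\<^sub>v w)"
      using w X by (simp add: kron_mult_kron_vec[OF one_carrier_mat d2 uc wc] one_mult_mat_vec[OF uc]
          weight_space_def kron_vec_smult[OF uc wc])
    also have "\<alpha> X \<cdot>\<^sub>v (u \<otimes>\<^sub>v w) + \<beta> X \<cdot>\<^sub>v (u \<otimes>\<^sub>v w) = (\<alpha> +\<^sub>w \<beta>) X \<cdot>\<^sub>v (u \<otimes>\<^sub>v w)"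
      by (simp add: weight_add_def add_smult_distrib_vec)
    also have "Z *\<^sub>v \<dots> = (\<alpha> +\<^sub>w \<beta>) X \<cdot>\<^sub>v (Z *\<^sub>v (u \<otimes>\<^sub>v w))"
      by (rule mult_mat_vec[OF Zc uw])
    finally show ?thesis .
  qed
  then show ?thesis
    using mult_mat_vec_carrier[OF Zc uw] by (simp add: weight_space_def)
qed

text \<open>The operator of X is diagonal in the orthonormal weight basis. Applying it therefore
  multiplies the coordinate of v along \<open>ket S l \<mu>\<close> by \<open>fst \<mu> X\<close>,
  while v itself is multiplied by \<open>\<alpha> X\<close>; if these differ, the coordinate is
  zero.\<close>

lemma weight_space_orthogonal_ket:
  assumes S: "rep_setting G S" and l: "l \<in> labels S" and \<mu>: "\<mu> \<in> wlabels G S l"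
    and v: "v \<in> weight_space G (id_chart S) (cartan S) (irr S l) \<alpha>"
    and X: "X \<in> cartan S" and ne: "\<alpha> X \<noteq> fst \<mu> X"
  shows "v \<bullet>c ket S l \<mu> = 0"
proof -
  let ?W = "wlabels G S l" and ?d = "rep_diff G (id_chart S) (irr S l) X"
  note frame = rep_setting_parseval_frame[OF S l]
  have vc: "v \<in> carrier_vec (ldim S l)" and dv: "?d *\<^sub>v v = \<alpha> X \<cdot>\<^sub>v v"
    using v X by (auto simp: weight_space_def)
  note d = rep_diff_carrier[of G "id_chart S" "irr S l" X]
  note kc = ket_carrier[OF S l]
  have basis: "orthonormal_weight_basis G S l" using S l by (auto simp: rep_setting_def)
  have "\<alpha> X * (v \<bullet>c ket S l \<mu>) = (?d *\<^sub>v v) \<bullet>c ket S l \<mu>"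
    using vc kc[OF \<mu>] by (simp add: dv)
  also have "\<dots> = v \<bullet>c (mat_adjoint ?d *\<^sub>v ket S l \<mu>)"
    by (rule cscalar_prod_adjoint[OF d vc kc[OF \<mu>]])
  also have "\<dots> = (\<Sum>\<nu>\<in>?W. (v \<bullet>c ket S l \<nu>) * (ket S l \<nu> \<bullet>c (mat_adjoint ?d *\<^sub>v ket S l \<mu>)))"
    by (rule parseval_frame_expansion[OF frame vc mult_mat_vec_carrier[OF mat_adjoint_carrier[OF d] kc[OF \<mu>]]])
  also have "\<dots> = (\<Sum>\<nu>\<in>?W. if \<nu> = \<mu> then (v \<bullet>c ket S l \<nu>) * fst \<nu> X else 0)"
  proof (intro sum.cong refl)
    fix \<nu> assume \<nu>: "\<nu> \<in> ?W"
    have "ket S l \<nu> \<bullet>c (mat_adjoint ?d *\<^sub>v ket S l \<mu>) = (?d *\<^sub>v ket S l \<nu>) \<bullet>c ket S l \<mu>"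
      by (rule cscalar_prod_adjoint[OF d kc[OF \<nu>] kc[OF \<mu>], symmetric])
    also have "?d *\<^sub>v ket S l \<nu> = fst \<nu> X \<cdot>\<^sub>v ket S l \<nu>"
      using basis \<nu> X by (auto simp: orthonormal_weight_basis_def weight_space_def)
    also have "\<dots> \<bullet>c ket S l \<mu> = fst \<nu> X * (if \<nu> = \<mu> then 1 else 0)"
      using basis \<nu> \<mu> kc[OF \<nu>] kc[OF \<mu>] by (simp add: orthonormal_weight_basis_def)
    finally show "(v \<bullet>c ket S l \<nu>) * (ket S l \<nu> \<bullet>c (mat_adjoint ?d *\<^sub>v ket S l \<mu>))
        = (if \<nu> = \<mu> then (v \<bullet>c ket S l \<nu>) * fst \<nu> X else 0)"
      by simp
  qed
  also have "\<dots> = (v \<bullet>c ket S l \<mu>) * fst \<mu> X"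
    using frame \<mu> by (simp add: parseval_frame_def)
  finally show ?thesis using ne by (simp add: mult.commute)
qed

lemma CG_eq_0:
  assumes G: "lie_group G" and S: "rep_setting G S" and l: "l1 \<in> labels S" "l2 \<in> labels S"
    and lk: "(l, k) \<in> cg_pairs G S l1 l2"
    and \<mu>: "\<mu>1 \<in> wlabels G S l1" "\<mu>2 \<in> wlabels G S l2" "\<mu> \<in> wlabels G S l"
    and ne: "fst \<mu> \<noteq> fst \<mu>1 +\<^sub>w fst \<mu>2"
  shows "CG S l1 l2 l k \<mu>1 \<mu>2 \<mu> = 0"
proof -
  let ?c = "id_chart S" and ?R = "irr S l" and ?R1 = "irr S l1" and ?R2 = "irr S l2"
  let ?Y = "inj_i S l1 l2 l k"
  have l': "l \<in> labels S" using lk by (auto simp: cg_pairs_def)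
  note u = rep_setting_unitary_family[OF S]
  have rep: "is_rep G (irr S l)" if "l \<in> labels S" for l
    using S that by (auto simp: rep_setting_def unitary_rep_def)
  have c: "?c \<in> lg_atlas G" "\<one>\<^bsub>G\<^esub> \<in> fst ?c" using S by (auto simp: rep_setting_def)
  have ket: "ket S l \<mu> \<in> weight_space G ?c (cartan S) (irr S l) (fst \<mu>)"
    if "l \<in> labels S" "\<mu> \<in> wlabels G S l" for l \<mu>
    using S that by (auto simp: rep_setting_def orthonormal_weight_basis_def)
  have vanish: "fst \<mu> X = 0" if "\<mu> \<in> wlabels G S l" "X \<notin> cartan S" for l \<mu> X
    using that by (auto simp: wlabels_def is_wt_def rep_weight_def)
  define v where "v = mat_adjoint ?Y *\<^sub>v (ket S l1 \<mu>1 \<otimes>\<^sub>v ket S l2 \<mu>2)"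
  have "intertwiner G (tensor_rep ?R1 ?R2) ?R (mat_adjoint ?Y)"
    by (rule intertwiner_adjoint[OF u[OF l'] unitary_family_tensor_rep[OF u[OF l(1)] u[OF l(2)]]
          intertwiner_inj_i[OF S l lk]])
  then have v: "v \<in> weight_space G ?c (cartan S) ?R (fst \<mu>1 +\<^sub>w fst \<mu>2)"
    unfolding v_def
    by (rule weight_space_kron_vec[OF G c rep[OF l'] rep[OF l(1)] rep[OF l(2)] _
          ket[OF l(1) \<mu>(1)] ket[OF l(2) \<mu>(2)]])
  have vc: "v \<in> carrier_vec (ldim S l)" using v by (simp add: weight_space_def)
  obtain X where X: "fst \<mu> X \<noteq> (fst \<mu>1 +\<^sub>w fst \<mu>2) X"
    using ne by (auto simp: fun_eq_iff)
  \<comment> \<open>Weights are extended by zero outside the Cartan subalgebra, so all three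
    functions vanish there and cannot differ.\<close>
  have "X \<in> cartan S"
  proof (rule ccontr)
    assume "X \<notin> cartan S"
    then show False
      using X vanish[OF \<mu>(1)] vanish[OF \<mu>(2)] vanish[OF \<mu>(3)] by (simp add: weight_add_def)
  qed
  then have "v \<bullet>c ket S l \<mu> = 0"
    using X by (intro weight_space_orthogonal_ket[OF S l' \<mu>(3) v]) auto
  then have "ket S l \<mu> \<bullet>c v = 0"
    using cnj_cscalar_prod[OF vc ket_carrier[OF S l' \<mu>(3)]] by simp
  then show ?thesis
    unfolding CG_def v_def
    by (simp only: cscalar_prod_adjoint[OF inj_i_carrier[OF S l lk] ket_carrier[OF S l' \<mu>(3)]
        kron_vec_carrier[OF ket_carrier[OF S l(1) \<mu>(1)] ket_carrier[OF S l(2) \<mu>(2)]]])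
qed

section \<open>Reduction of the sums over weights\<close>

text \<open>The source of the sums over multiplicity counters and of the \<open>is_wt\<close>
  conditions in the theorem: once the weight is forced to be \<open>a\<close>, only its counter is
  free, and if \<open>a\<close> is not a weight no label remains.\<close>

lemma sum_wlabels_of_weight:
  fixes f :: "_ \<Rightarrow> 'a::comm_monoid_add"
  assumes fin: "finite (wlabels G S l)"
    and f: "\<And>m. m \<in> wlabels G S l \<Longrightarrow> fst m \<noteq> a \<Longrightarrow> f m = 0"
  shows "(\<Sum>m\<in>wlabels G S l. f m) = (if is_wt G S l a then \<Sum>c = 1..wt_mult G S l a. f (a, c) else 0)"
proof -
  have "(\<Sum>m\<in>wlabels G S l. f m) = (\<Sum>m | m \<in> wlabels G S l \<and> fst m = a. f m)"
    using f by (intro sum.mono_neutral_right fin) auto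
  also have "{m \<in> wlabels G S l. fst m = a} = (if is_wt G S l a then Pair a ` {1..wt_mult G S l a} else {})"
    by (auto simp: wlabels_def)
  finally show ?thesis
    by (simp add: sum.reindex inj_on_def)
qed

text \<open>Reconciles the two orders of summation in the theorem: the unrestricted sum has the
  column labels outside the row labels, the sums over counters have them inside.\<close>

lemma sum_swap4:
  "(\<Sum>a\<in>A. \<Sum>b\<in>B. \<Sum>c\<in>C. \<Sum>d\<in>D. f a b c d) = (\<Sum>c\<in>C. \<Sum>d\<in>D. \<Sum>a\<in>A. \<Sum>b\<in>B. f a b c d)"
proof -
  have "(\<Sum>x\<in>A \<times> B. \<Sum>y\<in>C \<times> D. f (fst x) (snd x) (fst y) (snd y))
      = (\<Sum>y\<in>C \<times> D. \<Sum>x\<in>A \<times> B. f (fst x) (snd x) (fst y) (snd y))"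
    by (rule sum.swap)
  then show ?thesis by (simp only: sum.cartesian_product' fst_conv snd_conv)
qed

text \<open>Each vanishing hypothesis leaves the other three arguments arbitrary. This suits a
  product, where one zero factor is enough, and allows the sums to be reduced one after the other
  from the inside.\<close>

lemma sum_wlabels4_of_weight:
  fixes f :: "_ \<Rightarrow> _ \<Rightarrow> _ \<Rightarrow> _ \<Rightarrow> 'a::comm_monoid_add"
  assumes fin: "finite (wlabels G S la)" "finite (wlabels G S lb)" "finite (wlabels G S lc)" "finite (wlabels G S ld)"
    and f: "\<And>m p q r. m \<in> wlabels G S la \<Longrightarrow> fst m \<noteq> a \<Longrightarrow> f m p q r = 0"
      "\<And>m p q r. p \<in> wlabels G S lb \<Longrightarrow> fst p \<noteq> b \<Longrightarrow> f m p q r = 0"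
      "\<And>m p q r. q \<in> wlabels G S lc \<Longrightarrow> fst q \<noteq> c \<Longrightarrow> f m p q r = 0"
      "\<And>m p q r. r \<in> wlabels G S ld \<Longrightarrow> fst r \<noteq> d \<Longrightarrow> f m p q r = 0"
  shows "(\<Sum>m\<in>wlabels G S la. \<Sum>p\<in>wlabels G S lb. \<Sum>q\<in>wlabels G S lc. \<Sum>r\<in>wlabels G S ld. f m p q r)
    = (if is_wt G S la a \<and> is_wt G S lb b \<and> is_wt G S lc c \<and> is_wt G S ld d
       then \<Sum>x = 1..wt_mult G S la a. \<Sum>y = 1..wt_mult G S lb b. \<Sum>z = 1..wt_mult G S lc c.
         \<Sum>t = 1..wt_mult G S ld d. f (a, x) (b, y) (c, z) (d, t)
       else 0)"
proof -
  have d: "(\<Sum>r\<in>wlabels G S ld. f m p q r)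
      = (if is_wt G S ld d then \<Sum>t = 1..wt_mult G S ld d. f m p q (d, t) else 0)" for m p q
    by (rule sum_wlabels_of_weight[OF fin(4)]) (rule f)
  have c: "(\<Sum>q\<in>wlabels G S lc. \<Sum>r\<in>wlabels G S ld. f m p q r)
      = (if is_wt G S lc c \<and> is_wt G S ld d
         then \<Sum>z = 1..wt_mult G S lc c. \<Sum>t = 1..wt_mult G S ld d. f m p (c, z) (d, t) else 0)" for m p
    by (subst sum_wlabels_of_weight[OF fin(3), of c]) (auto simp: f(3) d)
  have b: "(\<Sum>p\<in>wlabels G S lb. \<Sum>q\<in>wlabels G S lc. \<Sum>r\<in>wlabels G S ld. f m p q r)
      = (if is_wt G S lb b \<and> is_wt G S lc c \<and> is_wt G S ld d
         then \<Sum>y = 1..wt_mult G S lb b. \<Sum>z = 1..wt_mult G S lc c. \<Sum>t = 1..wt_mult G S ld d.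
           f m (b, y) (c, z) (d, t) else 0)" for m
    by (subst sum_wlabels_of_weight[OF fin(2), of b]) (auto simp: f(2) c)
  show ?thesis
    by (subst sum_wlabels_of_weight[OF fin(1), of a]) (auto simp: f(1) b)
qed

theorem mainTheorem3:
  fixes G :: "('g, 'e::real_normed_vector) lie_group"
    and S :: "('g, 'e, 'l) rep_data"
    and l11 l12 l21 l22 l31 l32 l1 l2 l3 :: 'l
    and k1 k2 k3 ku1 ku2 k :: nat
    and m3 :: "'e wlabel"
  assumes "compact_lie_group G"
    and "rep_setting G S"
    and "l11 \<in> labels S" "l12 \<in> labels S"
    and "l21 \<in> labels S" "l22 \<in> labels S"
    and "l31 \<in> labels S" "l32 \<in> labels S"
    and "(l1, k1) \<in> cg_pairs G S l11 l12"
    and "(l2, k2) \<in> cg_pairs G S l21 l22"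
    and "(l3, k3) \<in> cg_pairs G S l31 l32"
    and "(l31, ku1) \<in> cg_pairs G S l11 l21"
    and "(l32, ku2) \<in> cg_pairs G S l12 l22"
    and "(l3, k) \<in> cg_pairs G S l1 l2"
    and "m3 \<in> wlabels G S l3"
  shows "let
      N = nine_lambda G S
            l11 l12 l1 k1
            l21 l22 l2 k2
            l31 l32 l3 k3
            ku1 ku2 k;
      w = wlabels G S;
      F = (\<lambda>m11 m12 m21 m22 m31 m32 m1 m2.
            cnj (CG S l11 l12 l1 k1 m11 m12 m1) *
            cnj (CG S l21 l22 l2 k2 m21 m22 m2) *
            cnj (CG S l1 l2 l3 k m1 m2 m3) *
            CG S l11 l21 l31 ku1 m11 m21 m31 *
            CG S l12 l22 l32 ku2 m12 m22 m32 *
            CG S l31 l32 l3 k3 m31 m32 m3);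
      I = {(m11, m12, m21, m22).
            m11 \<in> w l11 \<and> m12 \<in> w l12 \<and> m21 \<in> w l21 \<and> m22 \<in> w l22 \<and>
            is_wt G S l1 (fst m11 +\<^sub>w fst m12) \<and>
            is_wt G S l2 (fst m21 +\<^sub>w fst m22) \<and>
            is_wt G S l31 (fst m11 +\<^sub>w fst m21) \<and>
            is_wt G S l32 (fst m12 +\<^sub>w fst m22)};
      J = {(m11, m12, m21, m22) \<in> I.
            (fst m11 +\<^sub>w fst m12) +\<^sub>w (fst m21 +\<^sub>w fst m22) = fst m3};
      inner_sum = (\<lambda>(m11, m12, m21, m22).
        let a1 = fst m11 +\<^sub>w fst m12;
            a2 = fst m21 +\<^sub>w fst m22;
            a31 = fst m11 +\<^sub>w fst m21;
            a32 = fst m12 +\<^sub>w fst m22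
        in \<Sum>c1 = 1..wt_mult G S l1 a1. \<Sum>c2 = 1..wt_mult G S l2 a2.
           \<Sum>c31 = 1..wt_mult G S l31 a31. \<Sum>c32 = 1..wt_mult G S l32 a32.
             F m11 m12 m21 m22 (a31, c31) (a32, c32) (a1, c1) (a2, c2))
    in N = (\<Sum>x\<in>I. inner_sum x) \<and>
       N = (\<Sum>x\<in>J. inner_sum x) \<and>
       N = (\<Sum>m11\<in>w l11. \<Sum>m12\<in>w l12. \<Sum>m21\<in>w l21. \<Sum>m22\<in>w l22.
            \<Sum>m31\<in>w l31. \<Sum>m32\<in>w l32. \<Sum>m1\<in>w l1. \<Sum>m2\<in>w l2.
              F m11 m12 m21 m22 m31 m32 m1 m2)"
proof -
  note G = assms(1) and S = assms(2) and l = assms(3-8) and p = assms(9-14) and m3 = assms(15)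
  have lie: "lie_group G" using G by (simp add: compact_lie_group_def)
  have l': "l1 \<in> labels S" "l2 \<in> labels S" "l3 \<in> labels S" using p by (auto simp: cg_pairs_def)
  have fin: "finite (wlabels G S l)" if "l \<in> labels S" for l
    using rep_setting_parseval_frame[OF S that] by (simp add: parseval_frame_def)
  let ?w = "wlabels G S"
  define N where "N = nine_lambda G S l11 l12 l1 k1 l21 l22 l2 k2 l31 l32 l3 k3 ku1 ku2 k"
  define F where "F = (\<lambda>m11 m12 m21 m22 m31 m32 m1 m2.
    cnj (CG S l11 l12 l1 k1 m11 m12 m1) * cnj (CG S l21 l22 l2 k2 m21 m22 m2) *
    cnj (CG S l1 l2 l3 k m1 m2 m3) * CG S l11 l21 l31 ku1 m11 m21 m31 *
    CG S l12 l22 l32 ku2 m12 m22 m32 * CG S l31 l32 l3 k3 m31 m32 m3)"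
  define I where "I = {(m11, m12, m21, m22). m11 \<in> ?w l11 \<and> m12 \<in> ?w l12 \<and> m21 \<in> ?w l21 \<and> m22 \<in> ?w l22 \<and>
    is_wt G S l1 (fst m11 +\<^sub>w fst m12) \<and> is_wt G S l2 (fst m21 +\<^sub>w fst m22) \<and>
    is_wt G S l31 (fst m11 +\<^sub>w fst m21) \<and> is_wt G S l32 (fst m12 +\<^sub>w fst m22)}"
  define J where "J = {(m11, m12, m21, m22) \<in> I. (fst m11 +\<^sub>w fst m12) +\<^sub>w (fst m21 +\<^sub>w fst m22) = fst m3}"
  define inner where "inner = (\<lambda>(m11, m12, m21, m22).
    \<Sum>c1 = 1..wt_mult G S l1 (fst m11 +\<^sub>w fst m12). \<Sum>c2 = 1..wt_mult G S l2 (fst m21 +\<^sub>w fst m22).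
    \<Sum>c31 = 1..wt_mult G S l31 (fst m11 +\<^sub>w fst m21). \<Sum>c32 = 1..wt_mult G S l32 (fst m12 +\<^sub>w fst m22).
      F m11 m12 m21 m22 (fst m11 +\<^sub>w fst m21, c31) (fst m12 +\<^sub>w fst m22, c32)
        (fst m11 +\<^sub>w fst m12, c1) (fst m21 +\<^sub>w fst m22, c2))"
  let ?W = "?w l11 \<times> ?w l12 \<times> ?w l21 \<times> ?w l22"
  have finW: "finite ?W" by (intro finite_cartesian_product fin l)
  have IW: "I \<subseteq> ?W" and JI: "J \<subseteq> I" by (auto simp: I_def J_def)
  have N: "N = (\<Sum>m11\<in>?w l11. \<Sum>m12\<in>?w l12. \<Sum>m21\<in>?w l21. \<Sum>m22\<in>?w l22.
      \<Sum>m31\<in>?w l31. \<Sum>m32\<in>?w l32. \<Sum>m1\<in>?w l1. \<Sum>m2\<in>?w l2. F m11 m12 m21 m22 m31 m32 m1 m2)"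
    unfolding N_def F_def by (rule nine_lambda_sum[OF S l p m3])
  \<comment> \<open>With the four outer labels fixed, the coefficients for the first two rows and
    the first two columns each force the weight of one intermediate label. Every remaining choice of
    weights makes one factor of F zero.\<close>
  have reduce: "(\<Sum>m31\<in>?w l31. \<Sum>m32\<in>?w l32. \<Sum>m1\<in>?w l1. \<Sum>m2\<in>?w l2. F m11 m12 m21 m22 m31 m32 m1 m2)
      = (if (m11, m12, m21, m22) \<in> I then inner (m11, m12, m21, m22) else 0)"
    if m: "m11 \<in> ?w l11" "m12 \<in> ?w l12" "m21 \<in> ?w l21" "m22 \<in> ?w l22" for m11 m12 m21 m22
  proof -
    have "(\<Sum>m31\<in>?w l31. \<Sum>m32\<in>?w l32. \<Sum>m1\<in>?w l1. \<Sum>m2\<in>?w l2. F m11 m12 m21 m22 m31 m32 m1 m2)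
        = (\<Sum>m1\<in>?w l1. \<Sum>m2\<in>?w l2. \<Sum>m31\<in>?w l31. \<Sum>m32\<in>?w l32. F m11 m12 m21 m22 m31 m32 m1 m2)"
      by (rule sum_swap4)
    also have "\<dots> = (if is_wt G S l1 (fst m11 +\<^sub>w fst m12) \<and> is_wt G S l2 (fst m21 +\<^sub>w fst m22) \<and>
          is_wt G S l31 (fst m11 +\<^sub>w fst m21) \<and> is_wt G S l32 (fst m12 +\<^sub>w fst m22)
        then inner (m11, m12, m21, m22) else 0)"
      unfolding inner_def prod.case
      by (rule sum_wlabels4_of_weight)
        (simp_all add: fin l l' F_def CG_eq_0[OF lie S l(1,2) p(1) m(1,2)] CG_eq_0[OF lie S l(3,4) p(2) m(3,4)]
          CG_eq_0[OF lie S l(1,3) p(4) m(1,3)] CG_eq_0[OF lie S l(2,4) p(5) m(2,4)])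
    finally show ?thesis using m by (simp add: I_def)
  qed
  have N_I: "N = (\<Sum>x\<in>I. inner x)"
  proof -
    have "N = (\<Sum>m11\<in>?w l11. \<Sum>m12\<in>?w l12. \<Sum>m21\<in>?w l21. \<Sum>m22\<in>?w l22.
        if (m11, m12, m21, m22) \<in> I then inner (m11, m12, m21, m22) else 0)"
      unfolding N by (intro sum.cong refl reduce)
    also have "\<dots> = (\<Sum>x\<in>?W. if x \<in> I then inner x else 0)"
      by (simp only: sum.cartesian_product')
    also have "\<dots> = (\<Sum>x\<in>I. inner x)"
      using IW by (simp add: sum.inter_restrict[OF finW, symmetric] Int_absorb1)
    finally show ?thesis .
  qed
  \<comment> \<open>The further restriction comes from the coefficient coupling l1 and l2 to l3:
    outside \<open>J\<close> its weights do not add up to that of \<open>m3\<close>, so it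
    annihilates every term of the inner sum.\<close>
  have "(\<Sum>x\<in>I. inner x) = (\<Sum>x\<in>J. inner x)"
  proof (rule sum.mono_neutral_right[OF finite_subset[OF IW finW] JI], rule ballI)
    fix x assume x: "x \<in> I - J"
    obtain m11 m12 m21 m22 where x': "x = (m11, m12, m21, m22)" by (cases x)
    define a1 a2 where "a1 = fst m11 +\<^sub>w fst m12" and "a2 = fst m21 +\<^sub>w fst m22"
    have "is_wt G S l1 a1" "is_wt G S l2 a2" and ne: "fst m3 \<noteq> a1 +\<^sub>w a2"
      using x by (auto simp: x' I_def J_def a1_def a2_def)
    then have "CG S l1 l2 l3 k (a1, c1) (a2, c2) m3 = 0"
      if "c1 \<in> {1..wt_mult G S l1 a1}" "c2 \<in> {1..wt_mult G S l2 a2}" for c1 c2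
      using that by (intro CG_eq_0[OF lie S l'(1,2) p(6)] m3) (auto simp: wlabels_def)
    then show "inner x = 0"
      unfolding x' inner_def prod.case a1_def[symmetric] a2_def[symmetric]
      by (intro sum.neutral ballI) (simp add: F_def)
  qed
  with N_I have N_J: "N = (\<Sum>x\<in>J. inner x)" by simp
  from N_I N_J N show ?thesis
    unfolding Let_def N_def J_def I_def inner_def F_def by (intro conjI)
qed

end
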